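(* Let $X\in L^2_{\mathbb P}(\Omega,\mathbb R^d)$, set $\mu:=X_\sharp\mathbb P\in\mathcal P_2(\mathbb R^d)$, and define $\mathcal C_X:L^2_\mu(\mathbb R^d,\mathbb R^d)\to L^2_{\mathbb P}(\Omega,\mathbb R^d)$ by $\mathcal C_X\xi:=\xi\circ X$. Then $\mathcal C_X$ is an isometry onto the closed subspace $L^2_{\mathbb P}(\Omega,\mathbb R^d;\sigma(X))$, and its adjoint $\mathcal C_X^\star:L^2_{\mathbb P}(\Omega,\mathbb R^d)\to L^2_\mu(\mathbb R^d,\mathbb R^d)$ is characterized by $$\int_{\mathbb R^d}\langle(\mathcal C_X^\star H)(x),\xi(x)\rangle\,\mathrm d\mu(x)=\int_\Omega\langle H(\omega),\xi\circ X(\omega)\rangle\,\mathrm d\mathbb P(\omega)$$ for every $H\in L^2_{\mathbb P}(\Omega,\mathbb R^d)$ and $\xi\in L^2_\mu(\mathbb R^d,\mathbb R^d)$. In particular $\mathcal C_X\mathcal C_X^\star$ is the orthogonal projection onto $L^2_{\mathbb P}(\Omega,\mathbb R^d;\sigma(X))$, i.e. $\mathcal C_X\mathcal C_X^\star H=\mathbb E[H\,|\,\sigma(X)]$. Lastly, if $\Phi\in C_b^2(\mathcal P_2(\mathbb R^d),\mathbb R)$, then the operator representing the Hessian $\nabla^2\widetilde\Phi(X)$ of its lift decomposes as $$\nabla^2\widetilde\Phi(X)=\mathcal M_X+\mathcal C_X\mathcal K_\mu\mathcal C_X^\star,$$ where $(\mathcal M_XH)(\omega)=\mathrm D_x\nabla_\mu\Phi(\mu)(X(\omega))H(\omega)$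 and $(\mathcal K_\mu\xi)(x)=\int_{\mathbb R^d}\nabla_\mu^2\Phi(\mu)(x,y)\xi(y)\,\mathrm d\mu(y)$. In particular, $L^2_{\mathbb P}(\Omega,\mathbb R^d;\sigma(X))$ is invariant under $\nabla^2\widetilde\Phi(X)$, and $$\nabla^2\widetilde\Phi(X)_{|L^2_{\mathbb P}(\Omega,\mathbb R^d;\sigma(X))}=\mathcal C_X\,\mathrm{Hess}\,\Phi(\mu)\,\mathcal C_X^\star .$$
   Context: $(\Omega,\mathcal A,\mathbb P)$ is a standard atomless probability space. $L^2_{\mathbb P}(\Omega,\mathbb R^d;\sigma(X))$ is the closed subspace of $L^2_{\mathbb P}(\Omega,\mathbb R^d)$ of $\sigma(X)$-measurable random variables (equivalently the closure of $\{\xi\circ X:\xi:\mathbb R^d\to\mathbb R^d\text{ bounded Borel}\}$), and $\mathbb E[\cdot|\sigma(X)]$ is the orthogonal projection onto it. $\mathcal P_2(\mathbb R^d)$: Borel probability measures with finite second moment; $\Gamma(\mu,\nu)$: transport plans; $W_{2,\gamma}(\mu,\nu)=(\int|x-y|^2\mathrm d\gamma)^{1/2}$; $\mathrm{Tan}_\mu\mathcal P_2(\mathbb R^d)$: closure in $L^2_\mu(\mathbb R^d,\mathbb R^d)$ of $\{\nabla\psi:\psi\in C_c^\infty(\mathbb R^d)\}$. $\Phi:\mathcal P_2(\mathbb R^d)\to\mathbb R$ is Fréchet differentiable at $\mu$ if there is $\nabla_\mu\Phi(\mu)\in\mathrm{Tan}_\mu\mathcal P_2(\mathbb R^d)$ with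 $\Phi(\nu)=\Phi(\mu)+\int\langle\nabla_\mu\Phi(\mu)(x),y-x\rangle\mathrm d\gamma(x,y)+\mathrm o(W_{2,\gamma}(\mu,\nu))$ for each $\nu\in\mathcal P_2(\mathbb R^d)$ and every $\gamma\in\Gamma(\mu,\nu)$ (vector-valued maps: componentwise). $\Phi\in C_b^2(\mathcal P_2(\mathbb R^d),\mathbb R)$ means that $(\mu,x)\mapsto\nabla_\mu\Phi(\mu)(x)$ is continuous and Fréchet differentiable, with $(\mu,x)\mapsto\mathrm D_x\nabla_\mu\Phi(\mu)(x)\in\mathbb R^{d\times d}$ and $(\mu,x,y)\mapsto\nabla^2_\mu\Phi(\mu)(x,y)\in\mathbb R^{d\times d}$ (the derivative in $\mu$ of $\nabla_\mu\Phi(\mu)(x)$, evaluated at $y$) continuous and bounded. The Wasserstein Hessian is the operator on $L^2_\mu(\mathbb R^d,\mathbb R^d)$ $$(\mathrm{Hess}\,\Phi(\mu)\xi)(x)=\mathrm D_x\nabla_\mu\Phi(\mu)(x)\xi(x)+\int_{\mathbb R^d}\nabla_\mu^2\Phi(\mu)(x,y)\xi(y)\,\mathrm d\mu(y).$$ The lift of $\Phi$ is $\widetilde\Phi(X)=\Phi(X_\sharp\mathbb P)$ on $L^2_{\mathbb P}(\Omega,\mathbb R^d)$. Its Hessian at $X$ is the bilinear form $$\nabla^2\widetilde\Phi(X)(G,H)=\int_\Omega\big\langle\mathrm D_x\nabla_\mu\Phi(X_\sharp\mathbb P)(X(\omega))G(\omega),H(\omega)\big\rangle\mathrm d\mathbb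 P(\omega)+\int_\Omega\int_\Omega\big\langle\nabla^2_\mu\Phi(X_\sharp\mathbb P)(X(\omega),X(\theta))G(\theta),H(\omega)\big\rangle\mathrm d\mathbb P(\theta)\mathrm d\mathbb P(\omega),$$ and the operator representing it is the bounded operator $A$ on $L^2_{\mathbb P}(\Omega,\mathbb R^d)$ with $\langle AG,H\rangle=\nabla^2\widetilde\Phi(X)(G,H)$. *)

theory Defs
  imports "HOL-Probability.Probability"
begin

section \<open>Standard atomless probability spaces\<close>

definition polish_topology :: "'w topology \<Rightarrow> bool" where
  "polish_topology T \<longleftrightarrow> completely_metrizable_space T \<and> second_countable T"

text \<open>
  Standardness is understood modulo null sets (Lebesgue--Rokhlin): up to a null set, the completion
  of the space is the completion of a probability measure on the Borel sets of a Polish space.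
  This covers both a probability measure on a standard Borel space and its completion.
\<close>

definition standard_prob_space :: "'w measure \<Rightarrow> bool" where
  "standard_prob_space M \<longleftrightarrow> prob_space M \<and>
     (\<exists>T. polish_topology T \<and>
        topspace T \<subseteq> space M \<and> space M - topspace T \<in> null_sets (completion M) \<and>
        sigma_sets (topspace T) {U. openin T U} \<subseteq> sets (completion M) \<and>
        (\<forall>A \<in> sets (completion M). \<exists>B \<in> sigma_sets (topspace T) {U. openin T U}.
           B \<subseteq> A \<and> A - B \<in> null_sets (completion M)))"

definition atomless :: "'w measure \<Rightarrow> bool" where
  "atomless M \<longleftrightarrow> (\<forall>A \<in> sets M. emeasure M A > 0 \<longrightarrow>
     (\<exists>B \<in> sets M. B \<subseteq> A \<and> 0 < emeasure M B \<and> emeasure M B < emeasure M A))"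


section \<open>Square integrable vector fields\<close>

text \<open>
  Elements of \<open>L\<^sup>2\<close> are represented by functions; equality in \<open>L\<^sup>2\<close> is equality
  almost everywhere.
\<close>

definition L2 :: "'w measure \<Rightarrow> ('w \<Rightarrow> real ^ 'd) set" where
  "L2 M = {f \<in> borel_measurable M. integrable M (\<lambda>\<omega>. (norm (f \<omega>))\<^sup>2)}"

definition L2_inner :: "'w measure \<Rightarrow> ('w \<Rightarrow> real ^ 'd) \<Rightarrow> ('w \<Rightarrow> real ^ 'd) \<Rightarrow> real" where
  "L2_inner M f g = (\<integral>\<omega>. f \<omega> \<bullet> g \<omega> \<partial>M)"

definition L2_norm :: "'w measure \<Rightarrow> ('w \<Rightarrow> real ^ 'd) \<Rightarrow> real" where
  "L2_norm M f = sqrt (\<integral>\<omega>. (norm (f \<omega>))\<^sup>2 \<partial>M)"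

text \<open>
  Linearity is required almost everywhere; together with boundedness it makes the operator
  well defined on classes of almost everywhere equal functions.
\<close>

definition L2_bounded_operator ::
    "'v measure \<Rightarrow> 'w measure \<Rightarrow> (('v \<Rightarrow> real ^ 'd) \<Rightarrow> ('w \<Rightarrow> real ^ 'd)) \<Rightarrow> bool" where
  "L2_bounded_operator M N T \<longleftrightarrow>
     (\<forall>f \<in> L2 M. T f \<in> L2 N) \<and>
     (\<forall>f \<in> L2 M. \<forall>g \<in> L2 M. \<forall>a b :: real.
        AE \<omega> in N. T (\<lambda>x. a *\<^sub>R f x + b *\<^sub>R g x) \<omega> = a *\<^sub>R T f \<omega> + b *\<^sub>R T g \<omega>) \<and>
     (\<exists>c. \<forall>f \<in> L2 M. L2_norm N (T f) \<le> c * L2_norm M f)"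

definition L2_isometry ::
    "'v measure \<Rightarrow> 'w measure \<Rightarrow> (('v \<Rightarrow> real ^ 'd) \<Rightarrow> ('w \<Rightarrow> real ^ 'd)) \<Rightarrow> bool" where
  "L2_isometry M N T \<longleftrightarrow>
     L2_bounded_operator M N T \<and> (\<forall>f \<in> L2 M. L2_norm N (T f) = L2_norm M f)"

definition L2_closed_subspace :: "'w measure \<Rightarrow> ('w \<Rightarrow> real ^ 'd) set \<Rightarrow> bool" where
  "L2_closed_subspace M S \<longleftrightarrow>
     S \<subseteq> L2 M \<and> (\<lambda>\<omega>. 0) \<in> S \<and>
     (\<forall>f \<in> S. \<forall>g \<in> S. \<forall>a b :: real. (\<lambda>\<omega>. a *\<^sub>R f \<omega> + b *\<^sub>R g \<omega>) \<in> S) \<and>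
     (\<forall>u. \<forall>f \<in> L2 M. (\<forall>n :: nat. u n \<in> S) \<and>
        (\<lambda>n. L2_norm M (\<lambda>\<omega>. u n \<omega> - f \<omega>)) \<longlonglongrightarrow> 0 \<longrightarrow> f \<in> S)"

definition L2_orthogonal_projection ::
    "'w measure \<Rightarrow> ('w \<Rightarrow> real ^ 'd) set \<Rightarrow> (('w \<Rightarrow> real ^ 'd) \<Rightarrow> ('w \<Rightarrow> real ^ 'd)) \<Rightarrow> bool" where
  "L2_orthogonal_projection M S P \<longleftrightarrow>
     (\<forall>f \<in> L2 M. P f \<in> S \<and> (\<forall>g \<in> S. L2_inner M (\<lambda>\<omega>. f \<omega> - P f \<omega>) g = 0))"

text \<open>The adjoint of \<open>T : L\<^sup>2(M) \<rightarrow> L\<^sup>2(N)\<close>; it is determined almost everywhere.\<close>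

definition L2_adjoint ::
    "'v measure \<Rightarrow> 'w measure \<Rightarrow> (('v \<Rightarrow> real ^ 'd) \<Rightarrow> ('w \<Rightarrow> real ^ 'd)) \<Rightarrow>
     ('w \<Rightarrow> real ^ 'd) \<Rightarrow> ('v \<Rightarrow> real ^ 'd)" where
  "L2_adjoint M N T h =
     (SOME g. g \<in> L2 M \<and> (\<forall>f \<in> L2 M. L2_inner M g f = L2_inner N h (T f)))"

definition L2_represents ::
    "'w measure \<Rightarrow> (('w \<Rightarrow> real ^ 'd) \<Rightarrow> ('w \<Rightarrow> real ^ 'd)) \<Rightarrow>
     (('w \<Rightarrow> real ^ 'd) \<Rightarrow> ('w \<Rightarrow> real ^ 'd) \<Rightarrow> real) \<Rightarrow> bool" where
  "L2_represents M A B \<longleftrightarrow>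
     L2_bounded_operator M M A \<and> (\<forall>g \<in> L2 M. \<forall>h \<in> L2 M. L2_inner M (A g) h = B g h)"

definition sigma_gen :: "'w measure \<Rightarrow> ('w \<Rightarrow> real ^ 'd) \<Rightarrow> 'w measure" where
  "sigma_gen M X = vimage_algebra (space M) X borel"

text \<open>Membership asks for a \<open>\<sigma>(X)\<close>-measurable representative, so the set is saturated under
  almost everywhere equality.\<close>

definition L2_sigma :: "'w measure \<Rightarrow> ('w \<Rightarrow> real ^ 'd) \<Rightarrow> ('w \<Rightarrow> real ^ 'd) set" where
  "L2_sigma M X =
     {f \<in> L2 M. \<exists>g \<in> borel_measurable (sigma_gen M X). AE \<omega> in M. f \<omega> = g \<omega>}"

definition vec_cond_exp :: "'w measure \<Rightarrow> 'w measure \<Rightarrow> ('w \<Rightarrow> real ^ 'd) \<Rightarrow> ('w \<Rightarrow> real ^ 'd)" where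
  "vec_cond_exp M F f \<omega> = (\<chi> i. real_cond_exp M F (\<lambda>\<omega>. f \<omega> $ i) \<omega>)"


section \<open>Calculus on the Wasserstein space\<close>

definition P2 :: "(real ^ 'd) measure set" where
  "P2 = {\<mu>. prob_space \<mu> \<and> sets \<mu> = sets borel \<and> integrable \<mu> (\<lambda>x. (norm x)\<^sup>2)}"

definition transport_plans ::
    "(real ^ 'd) measure \<Rightarrow> (real ^ 'd) measure \<Rightarrow> ((real ^ 'd) \<times> (real ^ 'd)) measure set" where
  "transport_plans \<mu> \<nu> =
     {\<gamma>. prob_space \<gamma> \<and> sets \<gamma> = sets (borel \<Otimes>\<^sub>M borel) \<and>
         distr \<gamma> borel fst = \<mu> \<and> distr \<gamma> borel snd = \<nu>}"

definition W2_plan :: "((real ^ 'd) \<times> (real ^ 'd)) measure \<Rightarrow> real" where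
  "W2_plan \<gamma> = sqrt (\<integral>z. (norm (fst z - snd z))\<^sup>2 \<partial>\<gamma>)"

definition W2 :: "(real ^ 'd) measure \<Rightarrow> (real ^ 'd) measure \<Rightarrow> real" where
  "W2 \<mu> \<nu> = (INF \<gamma> \<in> transport_plans \<mu> \<nu>. W2_plan \<gamma>)"

text \<open>Joint continuity on \<open>P2 \<times> 'x\<close>, where \<open>P2\<close> carries the distance \<open>W2\<close>.\<close>

definition P2_continuous ::
    "((real ^ 'd) measure \<Rightarrow> 'x::metric_space \<Rightarrow> 'y::metric_space) \<Rightarrow> bool" where
  "P2_continuous F \<longleftrightarrow>
     (\<forall>\<mu> \<in> P2. \<forall>x. \<forall>e > 0. \<exists>r > 0. \<forall>\<nu> \<in> P2. \<forall>y.
        W2 \<mu> \<nu> < r \<and> dist x y < r \<longrightarrow> dist (F \<mu> x) (F \<nu> y) < e)"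

definition P2_bounded :: "((real ^ 'd) measure \<Rightarrow> 'x \<Rightarrow> 'y::real_normed_vector) \<Rightarrow> bool" where
  "P2_bounded F \<longleftrightarrow> (\<exists>c. \<forall>\<mu> \<in> P2. \<forall>x. norm (F \<mu> x) \<le> c)"

fun C_k :: "nat \<Rightarrow> (real ^ 'd \<Rightarrow> real) \<Rightarrow> bool" where
  "C_k 0 f \<longleftrightarrow> continuous_on UNIV f"
| "C_k (Suc k) f \<longleftrightarrow> (\<exists>g. (\<forall>x. GDERIV f x :> g x) \<and> (\<forall>i. C_k k (\<lambda>x. g x $ i)))"

definition test_function :: "(real ^ 'd \<Rightarrow> real) \<Rightarrow> bool" where
  "test_function \<psi> \<longleftrightarrow> (\<forall>k. C_k k \<psi>) \<and> compact (closure {x. \<psi> x \<noteq> 0})"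

definition Tan :: "(real ^ 'd) measure \<Rightarrow> (real ^ 'd \<Rightarrow> real ^ 'd) set" where
  "Tan \<mu> = {v \<in> L2 \<mu>. \<forall>e > 0. \<exists>\<psi> g. test_function \<psi> \<and> (\<forall>x. GDERIV \<psi> x :> g x) \<and>
              L2_norm \<mu> (\<lambda>x. v x - g x) < e}"

definition has_W_gradient ::
    "((real ^ 'd) measure \<Rightarrow> real) \<Rightarrow> (real ^ 'd) measure \<Rightarrow> (real ^ 'd \<Rightarrow> real ^ 'd) \<Rightarrow> bool" where
  "has_W_gradient \<Phi> \<mu> v \<longleftrightarrow> v \<in> Tan \<mu> \<and>
     (\<forall>e > 0. \<exists>r > 0. \<forall>\<nu> \<in> P2. \<forall>\<gamma> \<in> transport_plans \<mu> \<nu>. W2_plan \<gamma> < r \<longrightarrow>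
        \<bar>\<Phi> \<nu> - \<Phi> \<mu> - (\<integral>z. v (fst z) \<bullet> (snd z - fst z) \<partial>\<gamma>)\<bar> \<le> e * W2_plan \<gamma>)"

text \<open>
  \<open>D \<mu> x\<close> is \<open>\<nabla>\<^sub>\<mu>\<Phi>(\<mu>)(x)\<close> and \<open>D2 \<mu> x y\<close> is
  \<open>\<nabla>\<^sup>2\<^sub>\<mu>\<Phi>(\<mu>)(x,y)\<close>, whose \<open>i\<close>-th row is the gradient at \<open>\<mu>\<close> of the \<open>i\<close>-th component of
  \<open>\<nu> \<mapsto> D \<nu> x\<close>. A gradient is an \<open>L\<^sup>2(\<mu>)\<close> class, so the pointwise values of \<open>D\<close> and \<open>D2\<close> refer to
  versions that are jointly continuous in all arguments. Since the partial derivatives of \<open>D\<close> are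
  continuous, asking for them separately in \<open>\<mu>\<close> and \<open>x\<close> is the same as asking for joint
  differentiability in \<open>(\<mu>, x)\<close>.
\<close>

definition C2b_with ::
    "((real ^ 'd) measure \<Rightarrow> real) \<Rightarrow>
     ((real ^ 'd) measure \<Rightarrow> real ^ 'd \<Rightarrow> real ^ 'd) \<Rightarrow>
     ((real ^ 'd) measure \<Rightarrow> real ^ 'd \<Rightarrow> real ^ 'd \<Rightarrow> real ^ 'd ^ 'd) \<Rightarrow> bool" where
  "C2b_with \<Phi> D D2 \<longleftrightarrow>
     (\<forall>\<mu> \<in> P2. has_W_gradient \<Phi> \<mu> (D \<mu>)) \<and>
     P2_continuous D \<and>
     (\<forall>\<mu> \<in> P2. \<forall>x. D \<mu> differentiable (at x)) \<and>
     (\<forall>\<mu> \<in> P2. \<forall>x i. has_W_gradient (\<lambda>\<nu>. D \<nu> x $ i) \<mu> (\<lambda>y. D2 \<mu> x y $ i)) \<and>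
     P2_continuous (\<lambda>\<mu> x. jacobian (D \<mu>) (at x)) \<and>
     P2_bounded (\<lambda>\<mu> x. jacobian (D \<mu>) (at x)) \<and>
     P2_continuous (\<lambda>\<mu> (x, y). D2 \<mu> x y) \<and>
     P2_bounded (\<lambda>\<mu> (x, y). D2 \<mu> x y)"

definition C2b :: "((real ^ 'd) measure \<Rightarrow> real) \<Rightarrow> bool" where
  "C2b \<Phi> \<longleftrightarrow> (\<exists>D D2. C2b_with \<Phi> D D2)"

definition W_grad :: "((real ^ 'd) measure \<Rightarrow> real) \<Rightarrow> (real ^ 'd) measure \<Rightarrow> real ^ 'd \<Rightarrow> real ^ 'd" where
  "W_grad \<Phi> = (SOME D. \<exists>D2. C2b_with \<Phi> D D2)"

definition W_grad_x ::
    "((real ^ 'd) measure \<Rightarrow> real) \<Rightarrow> (real ^ 'd) measure \<Rightarrow> real ^ 'd \<Rightarrow> real ^ 'd ^ 'd" where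
  "W_grad_x \<Phi> \<mu> x = jacobian (W_grad \<Phi> \<mu>) (at x)"

definition W_grad2 ::
    "((real ^ 'd) measure \<Rightarrow> real) \<Rightarrow> (real ^ 'd) measure \<Rightarrow> real ^ 'd \<Rightarrow> real ^ 'd \<Rightarrow> real ^ 'd ^ 'd" where
  "W_grad2 \<Phi> = (SOME D2. C2b_with \<Phi> (W_grad \<Phi>) D2)"

lemma C2b_with_W_grad:
  assumes "C2b \<Phi>"
  shows "C2b_with \<Phi> (W_grad \<Phi>) (W_grad2 \<Phi>)"
proof -
  have "\<exists>D2. C2b_with \<Phi> (W_grad \<Phi>) D2"
    unfolding W_grad_def using assms unfolding C2b_def by (rule someI_ex)
  then show ?thesis
    unfolding W_grad2_def by (rule someI_ex)
qed


section \<open>Hessians\<close>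

definition C_op :: "('w \<Rightarrow> real ^ 'd) \<Rightarrow> (real ^ 'd \<Rightarrow> real ^ 'd) \<Rightarrow> ('w \<Rightarrow> real ^ 'd)" where
  "C_op X \<xi> = \<xi> \<circ> X"

definition M_op ::
    "((real ^ 'd) measure \<Rightarrow> real) \<Rightarrow> (real ^ 'd) measure \<Rightarrow> ('w \<Rightarrow> real ^ 'd) \<Rightarrow>
     ('w \<Rightarrow> real ^ 'd) \<Rightarrow> ('w \<Rightarrow> real ^ 'd)" where
  "M_op \<Phi> \<mu> X H \<omega> = W_grad_x \<Phi> \<mu> (X \<omega>) *v H \<omega>"

definition K_op ::
    "((real ^ 'd) measure \<Rightarrow> real) \<Rightarrow> (real ^ 'd) measure \<Rightarrow>
     (real ^ 'd \<Rightarrow> real ^ 'd) \<Rightarrow> (real ^ 'd \<Rightarrow> real ^ 'd)" where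
  "K_op \<Phi> \<mu> \<xi> x = (\<integral>y. W_grad2 \<Phi> \<mu> x y *v \<xi> y \<partial>\<mu>)"

definition W_hess ::
    "((real ^ 'd) measure \<Rightarrow> real) \<Rightarrow> (real ^ 'd) measure \<Rightarrow>
     (real ^ 'd \<Rightarrow> real ^ 'd) \<Rightarrow> (real ^ 'd \<Rightarrow> real ^ 'd)" where
  "W_hess \<Phi> \<mu> \<xi> x = W_grad_x \<Phi> \<mu> x *v \<xi> x + (\<integral>y. W_grad2 \<Phi> \<mu> x y *v \<xi> y \<partial>\<mu>)"

text \<open>The Hessian at \<open>X\<close> of the lift \<open>Y \<mapsto> \<Phi> (distr M borel Y)\<close>, as a bilinear form.\<close>

definition lift_hess ::
    "'w measure \<Rightarrow> ((real ^ 'd) measure \<Rightarrow> real) \<Rightarrow> ('w \<Rightarrow> real ^ 'd) \<Rightarrow>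
     ('w \<Rightarrow> real ^ 'd) \<Rightarrow> ('w \<Rightarrow> real ^ 'd) \<Rightarrow> real" where
  "lift_hess M \<Phi> X G H =
     (\<integral>\<omega>. (W_grad_x \<Phi> (distr M borel X) (X \<omega>) *v G \<omega>) \<bullet> H \<omega> \<partial>M) +
     (\<integral>\<omega>. (\<integral>\<theta>. (W_grad2 \<Phi> (distr M borel X) (X \<omega>) (X \<theta>) *v G \<theta>) \<bullet> H \<omega> \<partial>M) \<partial>M)"

end

theory Submission
  imports Defs
begin

text \<open>
  Write \<open>C \<xi> = \<xi> \<circ> X\<close>. By change of variables \<open>C\<close> preserves inner products. A field measurable for
  \<open>\<sigma>(X)\<close> factors through \<open>X\<close> (\<open>borel_measurable_vimage_algebra_factor\<close>), so the range of \<open>C\<close> is all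
  of \<open>L\<^sup>2(\<sigma>(X))\<close>.

  The adjoint comes from conditional expectation, so that no representation theorem for functionals
  on \<open>L\<^sup>2\<close> enters: \<open>E[H | \<sigma>(X)]\<close> factors as \<open>\<zeta> \<circ> X\<close>, and the defining property of the conditional
  expectation, transported to the law of \<open>X\<close>, says that \<open>\<zeta>\<close> is the adjoint at \<open>H\<close>
  (\<open>vec_cond_exp_factor\<close>). Since square integrable fields are determined almost everywhere by their
  inner products, \<open>\<zeta>\<close> agrees with the chosen adjoint, and \<open>C C\<^sup>* H = E[H | \<sigma>(X)]\<close> is the orthogonal
  projection. That the subspace is closed follows from the existence of this projection.

  For the Hessian, each row of \<open>y \<mapsto> \<nabla>\<^sup>2\<Phi>(\<mu>)(x, y)\<close> is a bounded, hence square integrable, test field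
  for the adjoint equation. Therefore \<open>(K C\<^sup>* G)(x)\<close> is the integral of \<open>\<nabla>\<^sup>2\<Phi>(\<mu>)(x, X \<theta>) G(\<theta>)\<close> over
  \<open>\<theta>\<close>; with \<open>x = X \<omega>\<close>, integrating against \<open>H \<omega>\<close> gives the second term of the Hessian form, without
  exchanging integrals (\<open>lift_hess_op_represents\<close>). A representing operator is unique up to null
  sets, which transfers the decomposition \<open>M + C K C\<^sup>*\<close> to every such operator. On the subspace one
  has \<open>H = (C\<^sup>* H) \<circ> X\<close>, which makes both summands functions of \<open>X\<close>.
\<close>

section \<open>Square integrable vector fields modulo null sets\<close>

lemma L2_measurable: "f \<in> L2 M \<Longrightarrow> f \<in> borel_measurable M"
  by (simp add: L2_def)

lemma L2_integrable_sq: "f \<in> L2 M \<Longrightarrow> integrable M (\<lambda>\<omega>. (norm (f \<omega>))\<^sup>2)"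
  by (simp add: L2_def)

lemma L2_lincomb:
  assumes f: "f \<in> L2 M" and g: "g \<in> L2 M"
  shows "(\<lambda>\<omega>. a *\<^sub>R f \<omega> + b *\<^sub>R g \<omega>) \<in> L2 M"
proof -
  note [measurable] = L2_measurable[OF f] L2_measurable[OF g]
  have bound: "(norm (a *\<^sub>R u + b *\<^sub>R v))\<^sup>2 \<le> 2 * a\<^sup>2 * (norm u)\<^sup>2 + 2 * b\<^sup>2 * (norm v)\<^sup>2"
    for u v :: "real ^ 'd"
  proof -
    have "(norm (a *\<^sub>R u + b *\<^sub>R v))\<^sup>2 \<le> (\<bar>a\<bar> * norm u + \<bar>b\<bar> * norm v)\<^sup>2"
      by (intro power_mono order_trans[OF norm_triangle_ineq]) auto
    also have "\<dots> \<le> 2 * (\<bar>a\<bar> * norm u)\<^sup>2 + 2 * (\<bar>b\<bar> * norm v)\<^sup>2"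
      using zero_le_power2[of "\<bar>a\<bar> * norm u - \<bar>b\<bar> * norm v"]
      by (simp add: power2_sum power2_diff)
    finally show ?thesis by (simp add: power_mult_distrib)
  qed
  have "integrable M (\<lambda>\<omega>. (norm (a *\<^sub>R f \<omega> + b *\<^sub>R g \<omega>))\<^sup>2)"
    by (rule Bochner_Integration.integrable_bound[where
          f = "\<lambda>\<omega>. 2 * a\<^sup>2 * (norm (f \<omega>))\<^sup>2 + 2 * b\<^sup>2 * (norm (g \<omega>))\<^sup>2"])
       (auto intro!: L2_integrable_sq f g order_trans[OF bound])
  then show ?thesis by (simp add: L2_def)
qed

lemma L2_zero: "(\<lambda>\<omega>. 0) \<in> L2 M"
  by (simp add: L2_def)

lemma L2_add: "f \<in> L2 M \<Longrightarrow> g \<in> L2 M \<Longrightarrow> (\<lambda>\<omega>. f \<omega> + g \<omega>) \<in> L2 M"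
  using L2_lincomb[of f M g 1 1] by simp

lemma L2_diff: "f \<in> L2 M \<Longrightarrow> g \<in> L2 M \<Longrightarrow> (\<lambda>\<omega>. f \<omega> - g \<omega>) \<in> L2 M"
  using L2_lincomb[of f M g 1 "-1"] by simp

lemma L2_cong_AE:
  assumes "f \<in> L2 M" "g \<in> borel_measurable M" "AE \<omega> in M. f \<omega> = g \<omega>"
  shows "g \<in> L2 M"
proof -
  note [measurable] = L2_measurable[OF assms(1)] assms(2)
  have "integrable M (\<lambda>\<omega>. (norm (f \<omega>))\<^sup>2) \<longleftrightarrow> integrable M (\<lambda>\<omega>. (norm (g \<omega>))\<^sup>2)"
    by (rule integrable_cong_AE) (use assms(3) in auto)
  with assms show ?thesis by (simp add: L2_def)
qed

lemma L2_integrable_inner: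
  assumes f: "f \<in> L2 M" and g: "g \<in> L2 M"
  shows "integrable M (\<lambda>\<omega>. f \<omega> \<bullet> g \<omega>)"
proof -
  note [measurable] = L2_measurable[OF f] L2_measurable[OF g]
  have bound: "\<bar>u \<bullet> v\<bar> \<le> (norm u)\<^sup>2 + (norm v)\<^sup>2" for u v :: "real ^ 'd"
  proof -
    have "2 * (norm u * norm v) \<le> (norm u)\<^sup>2 + (norm v)\<^sup>2"
      using sum_squares_bound[of "norm u" "norm v"] by simp
    moreover have "0 \<le> norm u * norm v" by simp
    ultimately show ?thesis using Cauchy_Schwarz_ineq2[of u v] by linarith
  qed
  show ?thesis
    by (rule Bochner_Integration.integrable_bound[where
          f = "\<lambda>\<omega>. (norm (f \<omega>))\<^sup>2 + (norm (g \<omega>))\<^sup>2"])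
       (auto intro!: L2_integrable_sq f g order_trans[OF bound])
qed

lemma L2_inner_commute: "L2_inner M f g = L2_inner M g f"
  by (simp add: L2_inner_def inner_commute)

lemma L2_inner_lincomb_left:
  assumes "f \<in> L2 M" "g \<in> L2 M" "h \<in> L2 M"
  shows "L2_inner M (\<lambda>\<omega>. a *\<^sub>R f \<omega> + b *\<^sub>R g \<omega>) h = a * L2_inner M f h + b * L2_inner M g h"
  using assms by (simp add: L2_inner_def inner_add_left L2_integrable_inner)

lemma L2_inner_diff_left:
  assumes "f \<in> L2 M" "g \<in> L2 M" "h \<in> L2 M"
  shows "L2_inner M (\<lambda>\<omega>. f \<omega> - g \<omega>) h = L2_inner M f h - L2_inner M g h"
  using L2_inner_lincomb_left[OF assms, of 1 "-1"] by simp

lemma L2_inner_add_left: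
  assumes "f \<in> L2 M" "g \<in> L2 M" "h \<in> L2 M"
  shows "L2_inner M (\<lambda>\<omega>. f \<omega> + g \<omega>) h = L2_inner M f h + L2_inner M g h"
  using L2_inner_lincomb_left[OF assms, of 1 1] by simp

lemma L2_inner_cong_AE:
  assumes "f \<in> L2 M" "f' \<in> L2 M" "g \<in> L2 M" "g' \<in> L2 M"
    and "AE \<omega> in M. f \<omega> = f' \<omega>" "AE \<omega> in M. g \<omega> = g' \<omega>"
  shows "L2_inner M f g = L2_inner M f' g'"
  unfolding L2_inner_def
proof (rule integral_cong_AE)
  show "AE \<omega> in M. f \<omega> \<bullet> g \<omega> = f' \<omega> \<bullet> g' \<omega>" using assms(5,6) by eventually_elim simp
qed (use assms in \<open>auto intro!: borel_measurable_inner L2_measurable\<close>)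

lemma L2_norm_nonneg: "0 \<le> L2_norm M f"
  by (simp add: L2_norm_def)

lemma L2_norm_sq: "(L2_norm M f)\<^sup>2 = L2_inner M f f"
  by (simp add: L2_norm_def L2_inner_def dot_square_norm)

lemma L2_norm_cong_AE:
  assumes "f \<in> L2 M" "g \<in> L2 M" "AE \<omega> in M. f \<omega> = g \<omega>"
  shows "L2_norm M f = L2_norm M g"
  using L2_inner_cong_AE[OF assms(1,2,1,2,3,3)] L2_norm_nonneg
  by (metis L2_norm_sq power2_eq_iff_nonneg)

lemma L2_eq_AE_if_norm_diff_zero:
  assumes f: "f \<in> L2 M" and g: "g \<in> L2 M"
    and z: "L2_norm M (\<lambda>\<omega>. f \<omega> - g \<omega>) = 0"
  shows "AE \<omega> in M. f \<omega> = g \<omega>"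
proof -
  have "(\<integral>\<omega>. (norm (f \<omega> - g \<omega>))\<^sup>2 \<partial>M) = 0"
    using z by (simp add: L2_norm_def)
  then have "AE \<omega> in M. (norm (f \<omega> - g \<omega>))\<^sup>2 = 0"
    using integral_nonneg_eq_0_iff_AE[OF L2_integrable_sq[OF L2_diff[OF f g]]] by simp
  then show ?thesis by eventually_elim simp
qed

text \<open>Test against the difference of the two fields.\<close>

lemma L2_eq_AE_if_same_inner:
  assumes f: "f \<in> L2 M" and g: "g \<in> L2 M"
    and same: "\<And>h. h \<in> L2 M \<Longrightarrow> L2_inner M f h = L2_inner M g h"
  shows "AE \<omega> in M. f \<omega> = g \<omega>"
proof (rule L2_eq_AE_if_norm_diff_zero[OF f g])
  have "(L2_norm M (\<lambda>\<omega>. f \<omega> - g \<omega>))\<^sup>2 = 0"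
    using L2_inner_diff_left[OF f g L2_diff[OF f g]] same[OF L2_diff[OF f g]]
    by (simp add: L2_norm_sq)
  then show "L2_norm M (\<lambda>\<omega>. f \<omega> - g \<omega>) = 0" by simp
qed

text \<open>
  The quadratic form \<open>(s, t) \<mapsto> \<parallel>s f + t g\<parallel>\<^sup>2\<close> is nonnegative, so its discriminant is at most
  zero.
\<close>

lemma L2_Cauchy_Schwarz:
  assumes f: "f \<in> L2 M" and g: "g \<in> L2 M"
  shows "\<bar>L2_inner M f g\<bar> \<le> L2_norm M f * L2_norm M g"
proof -
  define a b c where "a = L2_inner M f f" and "b = L2_inner M f g" and "c = L2_inner M g g"
  have quad: "0 \<le> s\<^sup>2 * a + 2 * s * t * b + t\<^sup>2 * c" for s t
  proof -
    define h where "h = (\<lambda>\<omega>. s *\<^sub>R f \<omega> + t *\<^sub>R g \<omega>)"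
    have h: "h \<in> L2 M" unfolding h_def by (rule L2_lincomb[OF f g])
    have "L2_inner M h h = s * L2_inner M f h + t * L2_inner M g h"
      using L2_inner_lincomb_left[OF f g h, of s t] by (simp add: h_def)
    also have "\<dots> = s * L2_inner M h f + t * L2_inner M h g"
      using L2_inner_commute[of M f h] L2_inner_commute[of M g h] by simp
    also have "L2_inner M h f = s * a + t * b"
      using L2_inner_lincomb_left[OF f g f, of s t] L2_inner_commute[of M g f]
      by (simp add: h_def a_def b_def)
    also have "L2_inner M h g = s * b + t * c"
      using L2_inner_lincomb_left[OF f g g, of s t] by (simp add: h_def b_def c_def)
    finally have "L2_inner M h h = s\<^sup>2 * a + 2 * s * t * b + t\<^sup>2 * c"
      by (simp add: algebra_simps power2_eq_square)
    then show ?thesis using L2_norm_sq[of M h] zero_le_power2[of "L2_norm M h"] by simp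
  qed
  have c: "0 \<le> c" using quad[of 0 1] by simp
  have "b\<^sup>2 \<le> a * c"
  proof (cases "c = 0")
    case True
    \<comment> \<open>Without a \<open>t\<^sup>2\<close> term the form at \<open>s = 1\<close> is affine in \<open>t\<close>; a nonzero slope would give it
      the value \<open>-1\<close>.\<close>
    have "b = 0"
    proof (rule ccontr)
      assume "b \<noteq> 0"
      then show False using quad[of 1 "- (a + 1) / (2 * b)"] True by (simp add: field_simps)
    qed
    then show ?thesis using True by simp
  next
    case False
    with c have "0 < c" by simp
    have "0 \<le> c * (a * c - b\<^sup>2)"
      using quad[of c "- b"] by (simp add: algebra_simps power2_eq_square)
    then show ?thesis using \<open>0 < c\<close> by (simp add: zero_le_mult_iff)
  qed
  then have "\<bar>b\<bar>\<^sup>2 \<le> (L2_norm M f * L2_norm M g)\<^sup>2"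
    by (simp add: power_mult_distrib L2_norm_sq a_def c_def)
  then show ?thesis
    unfolding b_def by (rule power2_le_imp_le) (simp add: L2_norm_nonneg)
qed

lemma L2_norm_triangle:
  assumes f: "f \<in> L2 M" and g: "g \<in> L2 M"
  shows "L2_norm M (\<lambda>\<omega>. f \<omega> + g \<omega>) \<le> L2_norm M f + L2_norm M g"
proof (rule power2_le_imp_le)
  let ?h = "\<lambda>\<omega>. f \<omega> + g \<omega>"
  have h: "?h \<in> L2 M" by (rule L2_add[OF f g])
  have "(L2_norm M ?h)\<^sup>2 = L2_inner M f ?h + L2_inner M g ?h"
    using L2_inner_add_left[OF f g h] by (simp add: L2_norm_sq)
  also have "\<dots> = L2_inner M ?h f + L2_inner M ?h g"
    using L2_inner_commute[of M f ?h] L2_inner_commute[of M g ?h] by simp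
  also have "\<dots> = L2_inner M f f + 2 * L2_inner M f g + L2_inner M g g"
    using L2_inner_add_left[OF f g f] L2_inner_add_left[OF f g g] L2_inner_commute[of M g f]
    by simp
  also have "\<dots> \<le> (L2_norm M f + L2_norm M g)\<^sup>2"
    using L2_Cauchy_Schwarz[OF f g] by (simp add: power2_sum L2_norm_sq)
  finally show "(L2_norm M ?h)\<^sup>2 \<le> (L2_norm M f + L2_norm M g)\<^sup>2" .
qed (intro add_nonneg_nonneg L2_norm_nonneg)

lemma (in prob_space) L2_integrable:
  assumes f: "f \<in> L2 M"
  shows "integrable M f"
proof -
  note [measurable] = L2_measurable[OF f]
  have "integrable M (\<lambda>\<omega>. norm (f \<omega>))"
    by (rule square_integrable_imp_integrable) (use L2_integrable_sq[OF f] in auto)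
  then show ?thesis by (rule integrable_norm_cancel) measurable
qed

text \<open>The variance of \<open>norm f\<close> is nonnegative.\<close>

lemma (in prob_space) integral_norm_le_L2_norm:
  assumes f: "f \<in> L2 M"
  shows "(\<integral>\<omega>. norm (f \<omega>) \<partial>M) \<le> L2_norm M f"
proof -
  have "(\<integral>\<omega>. norm (f \<omega>) \<partial>M)\<^sup>2 \<le> (\<integral>\<omega>. (norm (f \<omega>))\<^sup>2 \<partial>M)"
    using variance_eq[of "\<lambda>\<omega>. norm (f \<omega>)"] variance_positive[of "\<lambda>\<omega>. norm (f \<omega>)"]
      L2_integrable[OF f] L2_integrable_sq[OF f] by simp
  then show ?thesis unfolding L2_norm_def by (rule real_le_rsqrt)
qed

lemma (in prob_space) bounded_in_L2:
  assumes [measurable]: "f \<in> borel_measurable M" and b: "\<And>\<omega>. \<omega> \<in> space M \<Longrightarrow> norm (f \<omega>) \<le> c"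
  shows "f \<in> L2 M" and "L2_norm M f \<le> c"
proof -
  have sq: "(norm (f \<omega>))\<^sup>2 \<le> c\<^sup>2" if "\<omega> \<in> space M" for \<omega>
    by (rule power_mono[OF b[OF that]]) simp
  have int: "integrable M (\<lambda>\<omega>. (norm (f \<omega>))\<^sup>2)"
    by (rule integrable_const_bound[where B = "c\<^sup>2"]) (use sq in auto)
  then show "f \<in> L2 M" by (simp add: L2_def)
  have "0 \<le> c" using b norm_ge_zero order_trans not_empty by blast
  have "(\<integral>\<omega>. (norm (f \<omega>))\<^sup>2 \<partial>M) \<le> (\<integral>\<omega>. c\<^sup>2 \<partial>M)"
    by (rule integral_mono[OF int]) (use sq in auto)
  then have "(\<integral>\<omega>. (norm (f \<omega>))\<^sup>2 \<partial>M) \<le> c\<^sup>2" by (simp add: prob_space)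
  then show "L2_norm M f \<le> c"
    unfolding L2_norm_def using \<open>0 \<le> c\<close> by (simp add: real_le_lsqrt)
qed

section \<open>Bounded operators\<close>

lemma L2_bounded_operatorD:
  assumes "L2_bounded_operator M N T"
  shows "f \<in> L2 M \<Longrightarrow> T f \<in> L2 N"
    and "f \<in> L2 M \<Longrightarrow> g \<in> L2 M \<Longrightarrow>
      AE \<omega> in N. T (\<lambda>x. a *\<^sub>R f x + b *\<^sub>R g x) \<omega> = a *\<^sub>R T f \<omega> + b *\<^sub>R T g \<omega>"
  using assms by (auto simp: L2_bounded_operator_def)

text \<open>
  A bound \<open>c\<close> on an operator may always be enlarged to a nonnegative one, which makes products
  of bounds monotone.
\<close>

lemma L2_bounded_operator_bound:
  assumes "L2_bounded_operator M N T"
  obtains c where "0 \<le> c" "\<And>f. f \<in> L2 M \<Longrightarrow> L2_norm N (T f) \<le> c * L2_norm M f"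
proof -
  from assms obtain c where c: "\<forall>f \<in> L2 M. L2_norm N (T f) \<le> c * L2_norm M f"
    by (auto simp: L2_bounded_operator_def)
  have "L2_norm N (T f) \<le> \<bar>c\<bar> * L2_norm M f" if "f \<in> L2 M" for f
    using c that L2_norm_nonneg[of M f]
    by (meson abs_ge_self mult_right_mono order_trans)
  with that[of "\<bar>c\<bar>"] show thesis by simp
qed

lemma L2_bounded_operatorI:
  assumes "\<And>f. f \<in> L2 M \<Longrightarrow> T f \<in> L2 N"
    and "\<And>f g a b. f \<in> L2 M \<Longrightarrow> g \<in> L2 M \<Longrightarrow>
      AE \<omega> in N. T (\<lambda>x. a *\<^sub>R f x + b *\<^sub>R g x) \<omega> = a *\<^sub>R T f \<omega> + b *\<^sub>R T g \<omega>"
    and "\<And>f. f \<in> L2 M \<Longrightarrow> L2_norm N (T f) \<le> c * L2_norm M f"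
  shows "L2_bounded_operator M N T"
  using assms unfolding L2_bounded_operator_def by blast

text \<open>
  Linearity sends the difference of two almost everywhere equal fields to the difference of
  their images, and the bound makes that image vanish.
\<close>

lemma L2_bounded_operator_cong_AE:
  fixes f g :: "'v \<Rightarrow> real ^ 'd"
  assumes T: "L2_bounded_operator M N T" and f: "f \<in> L2 M" and g: "g \<in> L2 M"
    and eq: "AE \<omega> in M. f \<omega> = g \<omega>"
  shows "AE \<omega> in N. T f \<omega> = T g \<omega>"
proof (rule L2_eq_AE_if_norm_diff_zero)
  let ?d = "\<lambda>x. 1 *\<^sub>R f x + (-1) *\<^sub>R g x"
  note Tf = L2_bounded_operatorD(1)[OF T f] and Tg = L2_bounded_operatorD(1)[OF T g]
  have d: "?d \<in> L2 M" by (rule L2_lincomb[OF f g])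
  obtain c where c: "\<And>f. f \<in> L2 M \<Longrightarrow> L2_norm N (T f) \<le> c * L2_norm M f"
    using L2_bounded_operator_bound[OF T] by blast
  have "L2_norm M ?d = L2_norm M (\<lambda>x. 0 :: real ^ 'd)"
    by (rule L2_norm_cong_AE[OF d L2_zero]) (use eq in auto)
  then have z: "L2_norm M ?d = 0" by (simp add: L2_norm_def)
  have "L2_norm N (T ?d) = 0"
    using c[OF d] L2_norm_nonneg[of N "T ?d"] unfolding z by linarith
  moreover have "L2_norm N (\<lambda>\<omega>. T f \<omega> - T g \<omega>) = L2_norm N (T ?d)"
  proof (rule L2_norm_cong_AE[OF L2_diff[OF Tf Tg] L2_bounded_operatorD(1)[OF T d]])
    show "AE \<omega> in N. T f \<omega> - T g \<omega> = T ?d \<omega>"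
      using L2_bounded_operatorD(2)[OF T f g, of 1 "-1"] by eventually_elim simp
  qed
  ultimately show "L2_norm N (\<lambda>\<omega>. T f \<omega> - T g \<omega>) = 0" by simp
  show "T f \<in> L2 N" "T g \<in> L2 N" by (fact Tf, fact Tg)
qed

lemma L2_bounded_operator_compose:
  fixes S :: "('v \<Rightarrow> real ^ 'd) \<Rightarrow> ('w \<Rightarrow> real ^ 'd)"
  assumes S: "L2_bounded_operator M N S" and T: "L2_bounded_operator N Q T"
  shows "L2_bounded_operator M Q (\<lambda>f. T (S f))"
proof -
  obtain cS where cS: "\<And>f. f \<in> L2 M \<Longrightarrow> L2_norm N (S f) \<le> cS * L2_norm M f"
    using L2_bounded_operator_bound[OF S] by blast
  obtain cT where "0 \<le> cT" and cT: "\<And>f. f \<in> L2 N \<Longrightarrow> L2_norm Q (T f) \<le> cT * L2_norm N f"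
    using L2_bounded_operator_bound[OF T] by blast
  show ?thesis
  proof (rule L2_bounded_operatorI[where c = "cT * cS"])
    fix f g :: "'v \<Rightarrow> real ^ 'd" and a b :: real assume f: "f \<in> L2 M" and g: "g \<in> L2 M"
    note Sf = L2_bounded_operatorD(1)[OF S f] and Sg = L2_bounded_operatorD(1)[OF S g]
    show "AE \<omega> in Q. T (S (\<lambda>x. a *\<^sub>R f x + b *\<^sub>R g x)) \<omega> = a *\<^sub>R T (S f) \<omega> + b *\<^sub>R T (S g) \<omega>"
      using L2_bounded_operator_cong_AE[OF T L2_bounded_operatorD(1)[OF S L2_lincomb[OF f g]]
          L2_lincomb[OF Sf Sg] L2_bounded_operatorD(2)[OF S f g, of a b]]
        L2_bounded_operatorD(2)[OF T Sf Sg, of a b]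
      by eventually_elim simp
  next
    fix f :: "'v \<Rightarrow> real ^ 'd" assume f: "f \<in> L2 M"
    note Sf = L2_bounded_operatorD(1)[OF S f]
    show "T (S f) \<in> L2 Q" by (rule L2_bounded_operatorD(1)[OF T Sf])
    show "L2_norm Q (T (S f)) \<le> cT * cS * L2_norm M f"
      using cT[OF Sf] mult_left_mono[OF cS[OF f] \<open>0 \<le> cT\<close>] by (simp add: mult.assoc)
  qed
qed

lemma L2_bounded_operator_add:
  fixes S T :: "('v \<Rightarrow> real ^ 'd) \<Rightarrow> ('w \<Rightarrow> real ^ 'd)"
  assumes S: "L2_bounded_operator M N S" and T: "L2_bounded_operator M N T"
  shows "L2_bounded_operator M N (\<lambda>f \<omega>. S f \<omega> + T f \<omega>)"
proof -
  obtain cS where cS: "\<And>f. f \<in> L2 M \<Longrightarrow> L2_norm N (S f) \<le> cS * L2_norm M f"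
    using L2_bounded_operator_bound[OF S] by blast
  obtain cT where cT: "\<And>f. f \<in> L2 M \<Longrightarrow> L2_norm N (T f) \<le> cT * L2_norm M f"
    using L2_bounded_operator_bound[OF T] by blast
  show ?thesis
  proof (rule L2_bounded_operatorI[where c = "cS + cT"])
    fix f g :: "'v \<Rightarrow> real ^ 'd" and a b :: real assume f: "f \<in> L2 M" and g: "g \<in> L2 M"
    show "AE \<omega> in N. S (\<lambda>x. a *\<^sub>R f x + b *\<^sub>R g x) \<omega> + T (\<lambda>x. a *\<^sub>R f x + b *\<^sub>R g x) \<omega>
      = a *\<^sub>R (S f \<omega> + T f \<omega>) + b *\<^sub>R (S g \<omega> + T g \<omega>)"
      using L2_bounded_operatorD(2)[OF S f g, of a b] L2_bounded_operatorD(2)[OF T f g, of a b]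
      by eventually_elim (simp add: algebra_simps)
  next
    fix f :: "'v \<Rightarrow> real ^ 'd" assume f: "f \<in> L2 M"
    note Sf = L2_bounded_operatorD(1)[OF S f] and Tf = L2_bounded_operatorD(1)[OF T f]
    show "(\<lambda>\<omega>. S f \<omega> + T f \<omega>) \<in> L2 N" by (rule L2_add[OF Sf Tf])
    show "L2_norm N (\<lambda>\<omega>. S f \<omega> + T f \<omega>) \<le> (cS + cT) * L2_norm M f"
      using L2_norm_triangle[OF Sf Tf] cS[OF f] cT[OF f] by (simp add: algebra_simps)
  qed
qed

lemma norm_matrix_vector_mult_le:
  fixes A :: "real ^ 'm ^ 'n"
  shows "norm (A *v x) \<le> real CARD('n) * norm A * norm x"
proof -
  have "norm (A *v x) \<le> (\<Sum>i\<in>UNIV. \<bar>(A *v x) $ i\<bar>)" by (rule norm_le_l1_cart)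
  also have "\<dots> \<le> (\<Sum>i\<in>(UNIV :: 'n set). norm A * norm x)"
  proof (rule sum_mono)
    fix i
    have "\<bar>(A *v x) $ i\<bar> \<le> norm (A $ i) * norm x"
      by (simp add: matrix_vector_mul_component Cauchy_Schwarz_ineq2)
    also have "\<dots> \<le> norm A * norm x"
      by (intro mult_right_mono Finite_Cartesian_Product.norm_nth_le) simp
    finally show "\<bar>(A *v x) $ i\<bar> \<le> norm A * norm x" .
  qed
  finally show ?thesis by (simp add: mult.assoc)
qed

lemma borel_measurable_vec_lambda_iff:
  fixes f :: "'w \<Rightarrow> real ^ 'n"
  shows "f \<in> borel_measurable M \<longleftrightarrow> (\<forall>i. (\<lambda>\<omega>. f \<omega> $ i) \<in> borel_measurable M)"
proof -
  have "f \<in> borel_measurable M \<longleftrightarrow> (\<forall>b\<in>Basis. (\<lambda>\<omega>. f \<omega> \<bullet> b) \<in> borel_measurable M)"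
    by (rule borel_measurable_euclidean_space)
  also have "\<dots> \<longleftrightarrow> (\<forall>i. (\<lambda>\<omega>. f \<omega> $ i) \<in> borel_measurable M)"
    by (auto simp: Basis_vec_def cart_eq_inner_axis)
  finally show ?thesis .
qed

lemma borel_measurable_vec_nth:
  fixes f :: "'w \<Rightarrow> 'b::real_normed_vector ^ 'n"
  assumes "f \<in> borel_measurable M"
  shows "(\<lambda>\<omega>. f \<omega> $ i) \<in> borel_measurable M"
proof -
  have "(\<lambda>v :: 'b ^ 'n. v $ i) \<in> borel_measurable borel"
    by (intro borel_measurable_continuous_onI continuous_intros)
  from measurable_compose[OF assms this] show ?thesis .
qed

lemma borel_measurable_matrix_vector_mult:
  fixes A :: "'w \<Rightarrow> real ^ 'm ^ 'n"
  assumes "A \<in> borel_measurable M" "f \<in> borel_measurable M"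
  shows "(\<lambda>\<omega>. A \<omega> *v f \<omega>) \<in> borel_measurable M"
  unfolding borel_measurable_vec_lambda_iff matrix_vector_mul_component
  using assms by (auto intro!: borel_measurable_inner borel_measurable_vec_nth)

lemma L2_bounded_operator_multiplication:
  fixes B :: "'w \<Rightarrow> real ^ 'd ^ 'd"
  assumes B[measurable]: "B \<in> borel_measurable M" and c: "\<And>\<omega>. norm (B \<omega>) \<le> c"
  shows "L2_bounded_operator M M (\<lambda>f \<omega>. B \<omega> *v f \<omega>)"
proof (rule L2_bounded_operatorI[where c = "real CARD('d) * c"])
  fix f g :: "'w \<Rightarrow> real ^ 'd" and a b :: real assume "f \<in> L2 M" "g \<in> L2 M"
  show "AE \<omega> in M. B \<omega> *v (a *\<^sub>R f \<omega> + b *\<^sub>R g \<omega>) = a *\<^sub>R (B \<omega> *v f \<omega>) + b *\<^sub>R (B \<omega> *v g \<omega>)"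
    by (simp add: matrix_vector_right_distrib matrix_vector_mult_scaleR)
next
  fix f :: "'w \<Rightarrow> real ^ 'd" assume f: "f \<in> L2 M"
  note [measurable] = L2_measurable[OF f]
  let ?c = "real CARD('d) * c"
  have "0 \<le> c" using c norm_ge_zero order_trans by blast
  have meas [measurable]: "(\<lambda>\<omega>. B \<omega> *v f \<omega>) \<in> borel_measurable M"
    by (intro borel_measurable_matrix_vector_mult) measurable
  have bound: "(norm (B \<omega> *v f \<omega>))\<^sup>2 \<le> ?c\<^sup>2 * (norm (f \<omega>))\<^sup>2" for \<omega>
  proof -
    have "norm (B \<omega> *v f \<omega>) \<le> real CARD('d) * norm (B \<omega>) * norm (f \<omega>)"
      by (rule norm_matrix_vector_mult_le)
    also have "\<dots> \<le> ?c * norm (f \<omega>)" by (intro mult_right_mono mult_left_mono c) auto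
    finally show ?thesis by (simp add: power_mono flip: power_mult_distrib)
  qed
  have int: "integrable M (\<lambda>\<omega>. (norm (B \<omega> *v f \<omega>))\<^sup>2)"
    by (rule Bochner_Integration.integrable_bound[where f = "\<lambda>\<omega>. ?c\<^sup>2 * (norm (f \<omega>))\<^sup>2"])
       (auto intro!: L2_integrable_sq f order_trans[OF bound])
  then show "(\<lambda>\<omega>. B \<omega> *v f \<omega>) \<in> L2 M" by (simp add: L2_def)
  have "(\<integral>\<omega>. (norm (B \<omega> *v f \<omega>))\<^sup>2 \<partial>M) \<le> (\<integral>\<omega>. ?c\<^sup>2 * (norm (f \<omega>))\<^sup>2 \<partial>M)"
    by (rule integral_mono[OF int]) (use bound L2_integrable_sq[OF f] in auto)
  then have "(L2_norm M (\<lambda>\<omega>. B \<omega> *v f \<omega>))\<^sup>2 \<le> (?c * L2_norm M f)\<^sup>2"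
    by (simp add: L2_norm_def power_mult_distrib)
  then show "L2_norm M (\<lambda>\<omega>. B \<omega> *v f \<omega>) \<le> ?c * L2_norm M f"
    by (rule power2_le_imp_le) (use \<open>0 \<le> c\<close> L2_norm_nonneg[of M f] in simp)
qed

text \<open>
  A bounded kernel maps \<open>L\<^sup>2\<close> to bounded functions, because the \<open>L\<^sup>1\<close> norm is at most the \<open>L\<^sup>2\<close> norm
  on a probability space.
\<close>

lemma L2_bounded_operator_kernel:
  fixes k :: "'w \<Rightarrow> 'w \<Rightarrow> real ^ 'd ^ 'd"
  assumes "prob_space M"
    and k[measurable]: "(\<lambda>(x, y). k x y) \<in> borel_measurable (M \<Otimes>\<^sub>M M)"
    and c: "\<And>x y. norm (k x y) \<le> c"
  shows "L2_bounded_operator M M (\<lambda>f x. \<integral>y. k x y *v f y \<partial>M)"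
proof -
  interpret prob_space M by fact
  let ?c = "real CARD('d) * c"
  have "0 \<le> c" using c norm_ge_zero order_trans by blast
  have bound: "norm (k x y *v v) \<le> ?c * norm v" for x y v
  proof -
    have "norm (k x y *v v) \<le> real CARD('d) * norm (k x y) * norm v"
      by (rule norm_matrix_vector_mult_le)
    also have "\<dots> \<le> ?c * norm v" by (intro mult_right_mono mult_left_mono c) auto
    finally show ?thesis .
  qed
  have meas: "(\<lambda>(x, y). k x y *v f y) \<in> borel_measurable (M \<Otimes>\<^sub>M M)"
    if f: "f \<in> L2 M" for f
    using borel_measurable_matrix_vector_mult[OF k measurable_compose[OF measurable_snd
        L2_measurable[OF f]]] by (simp add: case_prod_beta)
  have int: "integrable M (\<lambda>y. k x y *v f y)" if f: "f \<in> L2 M" and x: "x \<in> space M" for f x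
  proof (rule Bochner_Integration.integrable_bound[where f = "\<lambda>y. ?c * norm (f y)"])
    show "(\<lambda>y. k x y *v f y) \<in> borel_measurable M"
      using measurable_Pair2[OF meas[OF f] x] by simp
  qed (use bound L2_integrable[OF f] \<open>0 \<le> c\<close> in auto)
  show ?thesis
  proof (rule L2_bounded_operatorI[where c = ?c])
    fix f g :: "'w \<Rightarrow> real ^ 'd" and a b :: real assume f: "f \<in> L2 M" and g: "g \<in> L2 M"
    show "AE x in M. (\<integral>y. k x y *v (a *\<^sub>R f y + b *\<^sub>R g y) \<partial>M)
      = a *\<^sub>R (\<integral>y. k x y *v f y \<partial>M) + b *\<^sub>R (\<integral>y. k x y *v g y \<partial>M)"
      by (rule AE_I2)
        (simp add: matrix_vector_right_distrib matrix_vector_mult_scaleR int[OF f] int[OF g])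
  next
    fix f :: "'w \<Rightarrow> real ^ 'd" assume f: "f \<in> L2 M"
    have m: "(\<lambda>x. \<integral>y. k x y *v f y \<partial>M) \<in> borel_measurable M"
      by (rule borel_measurable_lebesgue_integral[OF meas[OF f]])
    have "norm (\<integral>y. k x y *v f y \<partial>M) \<le> ?c * L2_norm M f" if x: "x \<in> space M" for x
    proof -
      have "norm (\<integral>y. k x y *v f y \<partial>M) \<le> (\<integral>y. norm (k x y *v f y) \<partial>M)"
        by (rule integral_norm_bound)
      also have "\<dots> \<le> (\<integral>y. ?c * norm (f y) \<partial>M)"
        by (rule integral_mono) (use bound int[OF f x] L2_integrable[OF f] in auto)
      also have "\<dots> \<le> ?c * L2_norm M f"
        using integral_norm_le_L2_norm[OF f] \<open>0 \<le> c\<close> by (simp add: mult_left_mono)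
      finally show ?thesis .
    qed
    note bounded_in_L2[OF m this]
    then show "(\<lambda>x. \<integral>y. k x y *v f y \<partial>M) \<in> L2 M"
      and "L2_norm M (\<lambda>x. \<integral>y. k x y *v f y \<partial>M) \<le> ?c * L2_norm M f" by blast+
  qed
qed

section \<open>Functions of a random vector\<close>

text \<open>
  Doob--Dynkin factorization. A simple function measurable for the preimage \<open>\<sigma>\<close>-algebra takes each
  of its finitely many values on a preimage \<open>X -` A\<close>, so it is a simple function of \<open>X\<close>; in general,
  approximate by simple functions and take the limit of their factors, which exists on the range
  of \<open>X\<close>.
\<close>

lemma borel_measurable_vimage_algebra_factor:
  fixes g :: "'w \<Rightarrow> 'b :: {banach, second_countable_topology}"
  assumes g: "g \<in> borel_measurable (vimage_algebra \<Omega> X N)" and X: "X \<in> \<Omega> \<rightarrow> space N"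
  obtains h where "h \<in> borel_measurable N" and "\<And>\<omega>. \<omega> \<in> \<Omega> \<Longrightarrow> g \<omega> = h (X \<omega>)"
proof -
  let ?V = "vimage_algebra \<Omega> X N"
  have simple: "\<exists>\<phi>. \<phi> \<in> borel_measurable N \<and> (\<forall>\<omega> \<in> \<Omega>. s \<omega> = \<phi> (X \<omega>))"
    if s: "simple_function ?V s" for s :: "'w \<Rightarrow> 'b"
  proof -
    have fin: "finite (s ` \<Omega>)" using simple_functionD(1)[OF s] by simp
    have "\<exists>A. A \<in> sets N \<and> s -` {y} \<inter> \<Omega> = X -` A \<inter> \<Omega>" for y
      using simple_functionD(2)[OF s, of "{y}"] sets_vimage_algebra2[OF X] by auto
    then obtain A where A[measurable]: "\<And>y. A y \<in> sets N"
      and pre: "\<And>y. s -` {y} \<inter> \<Omega> = X -` A y \<inter> \<Omega>" by metis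
    \<comment> \<open>The sets \<open>A y\<close> may overlap off the range of \<open>X\<close>; on the range they are disjoint.\<close>
    define \<phi> where "\<phi> x = (\<Sum>y\<in>s ` \<Omega>. indicat_real (A y) x *\<^sub>R y)" for x
    have "\<phi> \<in> borel_measurable N" unfolding \<phi>_def[abs_def] by measurable
    moreover have "s \<omega> = \<phi> (X \<omega>)" if \<omega>: "\<omega> \<in> \<Omega>" for \<omega>
    proof -
      have "indicat_real (A y) (X \<omega>) = (if y = s \<omega> then 1 else 0)" for y
        using pre[of y] \<omega> by (auto simp: indicator_def)
      then have "\<phi> (X \<omega>) = (\<Sum>y\<in>s ` \<Omega>. if y = s \<omega> then y else 0)"
        unfolding \<phi>_def by (intro sum.cong) auto
      then show ?thesis using fin \<omega> by (simp add: sum.delta')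
    qed
    ultimately show ?thesis by blast
  qed
  obtain F where F: "\<And>i. simple_function ?V (F i)"
    and lim: "\<And>\<omega>. \<omega> \<in> \<Omega> \<Longrightarrow> (\<lambda>i. F i \<omega>) \<longlonglongrightarrow> g \<omega>"
    using borel_measurable_implies_sequence_metric[OF g, of 0] by auto
  obtain \<phi> where \<phi>[measurable]: "\<And>i. \<phi> i \<in> borel_measurable N"
    and F_eq: "\<And>i \<omega>. \<omega> \<in> \<Omega> \<Longrightarrow> F i \<omega> = \<phi> i (X \<omega>)"
    using simple[OF F] by metis
  show thesis
  proof (rule that)
    show "(\<lambda>x. lim (\<lambda>i. \<phi> i x)) \<in> borel_measurable N" by measurable
    show "g \<omega> = lim (\<lambda>i. \<phi> i (X \<omega>))" if "\<omega> \<in> \<Omega>" for \<omega>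
      using limI[OF lim[OF that]] F_eq[OF that] by simp
  qed
qed

lemma L2_component_integrable_sq:
  assumes f: "f \<in> L2 M"
  shows "integrable M (\<lambda>\<omega>. (f \<omega> $ i)\<^sup>2)"
proof (rule Bochner_Integration.integrable_bound[OF L2_integrable_sq[OF f]])
  show "(\<lambda>\<omega>. (f \<omega> $ i)\<^sup>2) \<in> borel_measurable M"
    by (intro borel_measurable_power borel_measurable_vec_nth L2_measurable f)
  show "AE \<omega> in M. norm ((f \<omega> $ i)\<^sup>2) \<le> norm ((norm (f \<omega>))\<^sup>2)"
    by (rule AE_I2) (simp add: abs_le_square_iff[symmetric] component_le_norm_cart)
qed

lemma L2_if_components:
  fixes f :: "'w \<Rightarrow> real ^ 'd"
  assumes "f \<in> borel_measurable M" "\<And>i. integrable M (\<lambda>\<omega>. (f \<omega> $ i)\<^sup>2)"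
  shows "f \<in> L2 M"
proof -
  have "(norm (f \<omega>))\<^sup>2 = (\<Sum>i\<in>UNIV. (f \<omega> $ i)\<^sup>2)" for \<omega>
    unfolding power2_norm_eq_inner by (simp add: inner_vec_def power2_eq_square)
  with assms show ?thesis by (simp add: L2_def)
qed

lemma L2_integrable_component_mult:
  assumes f: "f \<in> L2 M" and g: "g \<in> L2 M"
  shows "integrable M (\<lambda>\<omega>. f \<omega> $ i * g \<omega> $ i)"
proof (rule Bochner_Integration.integrable_bound[where
      f = "\<lambda>\<omega>. (f \<omega> $ i)\<^sup>2 + (g \<omega> $ i)\<^sup>2"])
  show "integrable M (\<lambda>\<omega>. (f \<omega> $ i)\<^sup>2 + (g \<omega> $ i)\<^sup>2)"
    by (intro Bochner_Integration.integrable_add L2_component_integrable_sq f g)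
  show "(\<lambda>\<omega>. f \<omega> $ i * g \<omega> $ i) \<in> borel_measurable M"
    by (intro borel_measurable_times borel_measurable_vec_nth L2_measurable f g)
  have "\<bar>a * b\<bar> \<le> a\<^sup>2 + b\<^sup>2" for a b :: real
  proof -
    have "2 * \<bar>a * b\<bar> \<le> a\<^sup>2 + b\<^sup>2"
      using sum_squares_bound[of "\<bar>a\<bar>" "\<bar>b\<bar>"] by (simp add: abs_mult)
    then show ?thesis using abs_ge_zero[of "a * b"] by linarith
  qed
  then show "AE \<omega> in M. norm (f \<omega> $ i * g \<omega> $ i) \<le> norm ((f \<omega> $ i)\<^sup>2 + (g \<omega> $ i)\<^sup>2)"
    by simp
qed

lemma L2_inner_eq_sum:
  assumes f: "f \<in> L2 M" and g: "g \<in> L2 M"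
  shows "L2_inner M f g = (\<Sum>i\<in>UNIV. \<integral>\<omega>. f \<omega> $ i * g \<omega> $ i \<partial>M)"
  by (simp add: L2_inner_def inner_vec_def L2_integrable_component_mult[OF f g])

locale random_vector = prob_space M for M :: "'w measure" +
  fixes X :: "'w \<Rightarrow> real ^ 'd"
  assumes X_measurable[measurable]: "X \<in> borel_measurable M"
begin

abbreviation law :: "(real ^ 'd) measure" where
  "law \<equiv> distr M borel X"

abbreviation adj :: "('w \<Rightarrow> real ^ 'd) \<Rightarrow> (real ^ 'd \<Rightarrow> real ^ 'd)" where
  "adj \<equiv> L2_adjoint law M (C_op X)"

lemma prob_space_law: "prob_space law"
  by (rule prob_space_distr) measurable

lemma L2_law_iff: "\<xi> \<in> L2 law \<longleftrightarrow> \<xi> \<in> borel_measurable borel \<and> C_op X \<xi> \<in> L2 M"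
proof (cases "\<xi> \<in> borel_measurable borel")
  case True
  note [measurable] = True
  have "C_op X \<xi> \<in> borel_measurable M" unfolding C_op_def comp_def by measurable
  moreover have "integrable law (\<lambda>x. (norm (\<xi> x))\<^sup>2) \<longleftrightarrow> integrable M (\<lambda>\<omega>. (norm (\<xi> (X \<omega>)))\<^sup>2)"
    by (rule integrable_distr_eq) measurable
  ultimately show ?thesis using True by (simp add: L2_def C_op_def)
qed (simp add: L2_def)

lemma L2_law_measurable: "\<xi> \<in> L2 law \<Longrightarrow> \<xi> \<in> borel_measurable borel"
  by (simp add: L2_def)

lemma C_op_L2: "\<xi> \<in> L2 law \<Longrightarrow> C_op X \<xi> \<in> L2 M"
  by (simp add: L2_law_iff)

lemma C_op_inner:
  assumes "\<xi> \<in> L2 law" "\<eta> \<in> L2 law"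
  shows "L2_inner M (C_op X \<xi>) (C_op X \<eta>) = L2_inner law \<xi> \<eta>"
proof -
  note [measurable] = L2_law_measurable[OF assms(1)] L2_law_measurable[OF assms(2)]
  have "(\<integral>x. \<xi> x \<bullet> \<eta> x \<partial>law) = (\<integral>\<omega>. \<xi> (X \<omega>) \<bullet> \<eta> (X \<omega>) \<partial>M)"
    by (rule integral_distr) measurable
  then show ?thesis by (simp add: L2_inner_def C_op_def)
qed

lemma C_op_norm: "\<xi> \<in> L2 law \<Longrightarrow> L2_norm M (C_op X \<xi>) = L2_norm law \<xi>"
  using C_op_inner[of \<xi> \<xi>] unfolding L2_norm_sq[symmetric]
  by (simp add: power2_eq_iff_nonneg L2_norm_nonneg)

lemma C_op_isometry: "L2_isometry law M (C_op X)"
  unfolding L2_isometry_def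
proof (intro conjI ballI)
  show "L2_bounded_operator law M (C_op X)"
  proof (rule L2_bounded_operatorI[where c = 1])
    fix f g :: "real ^ 'd \<Rightarrow> real ^ 'd" and a b :: real
    show "AE \<omega> in M. C_op X (\<lambda>x. a *\<^sub>R f x + b *\<^sub>R g x) \<omega>
      = a *\<^sub>R C_op X f \<omega> + b *\<^sub>R C_op X g \<omega>"
      by (simp add: C_op_def)
  qed (simp_all add: C_op_L2 C_op_norm)
qed (rule C_op_norm)

lemma C_op_cong_AE: "AE x in law. \<xi> x = \<eta> x \<Longrightarrow> AE \<omega> in M. C_op X \<xi> \<omega> = C_op X \<eta> \<omega>"
  using AE_distrD[OF X_measurable] by (simp add: C_op_def)

lemma subalgebra_sigma_gen: "subalgebra M (sigma_gen M X)"
  using sets_image_in_sets[OF refl X_measurable] by (simp add: subalgebra_def sigma_gen_def)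

lemma C_op_measurable_sigma_gen:
  assumes "\<xi> \<in> borel_measurable borel"
  shows "C_op X \<xi> \<in> borel_measurable (sigma_gen M X)"
proof -
  have "X \<in> measurable (sigma_gen M X) borel"
    unfolding sigma_gen_def by (rule measurable_vimage_algebra1) simp
  from measurable_compose[OF this assms] show ?thesis by (simp add: C_op_def comp_def)
qed

lemma sigma_gen_factor:
  fixes g :: "'w \<Rightarrow> real ^ 'd"
  assumes "g \<in> borel_measurable (sigma_gen M X)"
  obtains \<xi> where "\<xi> \<in> borel_measurable borel" and "\<And>\<omega>. \<omega> \<in> space M \<Longrightarrow> g \<omega> = C_op X \<xi> \<omega>"
proof -
  have X: "X \<in> space M \<rightarrow> space borel" by simp
  from borel_measurable_vimage_algebra_factor[OF assms[unfolded sigma_gen_def] X] that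
  show thesis by (auto simp: C_op_def)
qed

lemma C_op_in_L2_sigma:
  assumes "\<xi> \<in> L2 law"
  shows "C_op X \<xi> \<in> L2_sigma M X"
  using C_op_L2[OF assms] C_op_measurable_sigma_gen[OF L2_law_measurable[OF assms]]
  unfolding L2_sigma_def by auto

lemma L2_sigma_cong_AE:
  assumes "f \<in> L2_sigma M X" "g \<in> L2 M" "AE \<omega> in M. f \<omega> = g \<omega>"
  shows "g \<in> L2_sigma M X"
proof -
  from assms(1) obtain h where h: "h \<in> borel_measurable (sigma_gen M X)"
    and fh: "AE \<omega> in M. f \<omega> = h \<omega>"
    by (auto simp: L2_sigma_def)
  have "AE \<omega> in M. g \<omega> = h \<omega>" using assms(3) fh by eventually_elim simp
  with assms(2) h show ?thesis by (auto simp: L2_sigma_def)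
qed

lemma L2_sigma_obtain_C_op:
  assumes G: "G \<in> L2_sigma M X"
  obtains \<xi> where "\<xi> \<in> L2 law" and "AE \<omega> in M. G \<omega> = C_op X \<xi> \<omega>"
proof -
  from G obtain g where g: "g \<in> borel_measurable (sigma_gen M X)"
    and L2: "G \<in> L2 M" and Gg: "AE \<omega> in M. G \<omega> = g \<omega>"
    by (auto simp: L2_sigma_def)
  obtain \<xi> where \<xi>[measurable]: "\<xi> \<in> borel_measurable borel"
    and g_eq: "\<And>\<omega>. \<omega> \<in> space M \<Longrightarrow> g \<omega> = C_op X \<xi> \<omega>"
    using sigma_gen_factor[OF g] by blast
  have eq: "AE \<omega> in M. G \<omega> = C_op X \<xi> \<omega>"
    using Gg AE_space by eventually_elim (simp add: g_eq)
  have "C_op X \<xi> \<in> borel_measurable M" unfolding C_op_def comp_def by measurable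
  from L2_cong_AE[OF L2 this eq] \<xi> have "\<xi> \<in> L2 law" by (simp add: L2_law_iff)
  from that[OF this eq] show thesis .
qed

lemma L2_sigma_lincomb:
  assumes f: "f \<in> L2_sigma M X" and g: "g \<in> L2_sigma M X"
  shows "(\<lambda>\<omega>. a *\<^sub>R f \<omega> + b *\<^sub>R g \<omega>) \<in> L2_sigma M X"
proof -
  obtain \<xi> where \<xi>: "\<xi> \<in> L2 law" and f_eq: "AE \<omega> in M. f \<omega> = C_op X \<xi> \<omega>"
    using L2_sigma_obtain_C_op[OF f] by blast
  obtain \<eta> where \<eta>: "\<eta> \<in> L2 law" and g_eq: "AE \<omega> in M. g \<omega> = C_op X \<eta> \<omega>"
    using L2_sigma_obtain_C_op[OF g] by blast
  have "f \<in> L2 M" "g \<in> L2 M" using f g by (auto simp: L2_sigma_def)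
  note L2_lincomb[OF this, of a b]
  moreover have "AE \<omega> in M. C_op X (\<lambda>x. a *\<^sub>R \<xi> x + b *\<^sub>R \<eta> x) \<omega> = a *\<^sub>R f \<omega> + b *\<^sub>R g \<omega>"
    using f_eq g_eq by eventually_elim (simp add: C_op_def)
  ultimately show ?thesis
    by (rule L2_sigma_cong_AE[OF C_op_in_L2_sigma[OF L2_lincomb[OF \<xi> \<eta>, of a b]]])
qed

text \<open>
  The conditional expectation given \<open>X\<close> is a function of \<open>X\<close>, and testing it against another
  function of \<open>X\<close> is the same as testing the field itself. Its factor therefore satisfies the
  equation that defines the adjoint; square integrability is Jensen's inequality in each
  component.
\<close>

lemma vec_cond_exp_factor:
  assumes H: "H \<in> L2 M"
  obtains \<zeta> where "\<zeta> \<in> L2 law"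
    and "\<And>\<omega>. \<omega> \<in> space M \<Longrightarrow> vec_cond_exp M (sigma_gen M X) H \<omega> = C_op X \<zeta> \<omega>"
    and "\<And>\<xi>. \<xi> \<in> L2 law \<Longrightarrow> L2_inner law \<zeta> \<xi> = L2_inner M H (C_op X \<xi>)"
proof -
  interpret finite_measure_subalgebra M "sigma_gen M X"
    by unfold_locales (rule subalgebra_sigma_gen)
  let ?F = "sigma_gen M X"
  let ?E = "vec_cond_exp M ?F H"
  have E_nth: "?E \<omega> $ i = real_cond_exp M ?F (\<lambda>\<omega>. H \<omega> $ i) \<omega>" for \<omega> i
    by (simp add: vec_cond_exp_def)
  have H_meas: "(\<lambda>\<omega>. H \<omega> $ i) \<in> borel_measurable M" for i
    by (rule borel_measurable_vec_nth[OF L2_measurable[OF H]])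
  have H_int: "integrable M (\<lambda>\<omega>. H \<omega> $ i)" for i
    by (rule square_integrable_imp_integrable[OF H_meas L2_component_integrable_sq[OF H]])
  have E_F: "?E \<in> borel_measurable ?F"
    unfolding borel_measurable_vec_lambda_iff E_nth by simp
  have E_sq: "integrable M (\<lambda>\<omega>. (?E \<omega> $ i)\<^sup>2)" for i
    unfolding E_nth
    by (rule integrable_convex_cond_exp[where I = UNIV and q = "\<lambda>x. x\<^sup>2"])
       (use H_int L2_component_integrable_sq[OF H] in \<open>auto intro: convex_power2\<close>)
  have E: "?E \<in> L2 M"
    by (rule L2_if_components[OF measurable_from_subalg[OF subalgebra_sigma_gen E_F] E_sq])
  obtain \<zeta> where \<zeta>[measurable]: "\<zeta> \<in> borel_measurable borel"
    and E_eq: "\<And>\<omega>. \<omega> \<in> space M \<Longrightarrow> ?E \<omega> = C_op X \<zeta> \<omega>"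
    using sigma_gen_factor[OF E_F] by blast
  have C\<zeta>: "C_op X \<zeta> \<in> borel_measurable M" unfolding C_op_def comp_def by measurable
  have AE_eq: "AE \<omega> in M. ?E \<omega> = C_op X \<zeta> \<omega>" using E_eq by simp
  from L2_cong_AE[OF E C\<zeta> AE_eq] have \<zeta>_L2: "\<zeta> \<in> L2 law" by (simp add: L2_law_iff)
  show thesis
  proof (rule that[OF \<zeta>_L2 E_eq])
    fix \<xi> :: "real ^ 'd \<Rightarrow> real ^ 'd" assume \<xi>: "\<xi> \<in> L2 law"
    have C\<xi>: "C_op X \<xi> \<in> L2 M" by (rule C_op_L2[OF \<xi>])
    have C\<xi>_F: "(\<lambda>\<omega>. C_op X \<xi> \<omega> $ i) \<in> borel_measurable ?F" for i
      by (intro borel_measurable_vec_nth C_op_measurable_sigma_gen L2_law_measurable \<xi>)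
    have "L2_inner law \<zeta> \<xi> = L2_inner M ?E (C_op X \<xi>)"
      using C_op_inner[OF \<zeta>_L2 \<xi>] L2_inner_cong_AE[OF E C_op_L2[OF \<zeta>_L2] C\<xi> C\<xi> AE_eq] by simp
    also have "\<dots> = (\<Sum>i\<in>UNIV. \<integral>\<omega>. C_op X \<xi> \<omega> $ i * real_cond_exp M ?F (\<lambda>\<omega>. H \<omega> $ i) \<omega> \<partial>M)"
      by (simp add: L2_inner_commute[of M ?E] L2_inner_eq_sum[OF C\<xi> E] E_nth)
    also have "\<dots> = (\<Sum>i\<in>UNIV. \<integral>\<omega>. C_op X \<xi> \<omega> $ i * H \<omega> $ i \<partial>M)"
      by (intro sum.cong refl real_cond_exp_intg(2) C\<xi>_F H_meas
          L2_integrable_component_mult[OF C\<xi> H])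
    also have "\<dots> = L2_inner M H (C_op X \<xi>)"
      by (simp add: L2_inner_commute[of M H] L2_inner_eq_sum[OF C\<xi> H])
    finally show "L2_inner law \<zeta> \<xi> = L2_inner M H (C_op X \<xi>)" .
  qed
qed

lemma adj_spec:
  assumes H: "H \<in> L2 M"
  shows "adj H \<in> L2 law \<and> (\<forall>\<xi> \<in> L2 law. L2_inner law (adj H) \<xi> = L2_inner M H (C_op X \<xi>))"
proof -
  have "\<exists>\<eta>. \<eta> \<in> L2 law \<and> (\<forall>\<xi> \<in> L2 law. L2_inner law \<eta> \<xi> = L2_inner M H (C_op X \<xi>))"
    by (rule vec_cond_exp_factor[OF H]) (intro exI conjI ballI)
  from someI_ex[OF this] show ?thesis unfolding L2_adjoint_def .
qed

lemma adj_in_L2: "H \<in> L2 M \<Longrightarrow> adj H \<in> L2 law"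
  using adj_spec by blast

lemma adj_inner:
  "H \<in> L2 M \<Longrightarrow> \<xi> \<in> L2 law \<Longrightarrow> L2_inner law (adj H) \<xi> = L2_inner M H (C_op X \<xi>)"
  using adj_spec by blast

lemma adj_unique:
  assumes H: "H \<in> L2 M" and \<eta>: "\<eta> \<in> L2 law"
    and inner: "\<And>\<xi>. \<xi> \<in> L2 law \<Longrightarrow> L2_inner law \<eta> \<xi> = L2_inner M H (C_op X \<xi>)"
  shows "AE x in law. \<eta> x = adj H x"
proof (rule L2_eq_AE_if_same_inner[OF \<eta> adj_in_L2[OF H]])
  show "L2_inner law \<eta> \<xi> = L2_inner law (adj H) \<xi>" if "\<xi> \<in> L2 law" for \<xi>
    unfolding inner[OF that] adj_inner[OF H that] ..
qed

lemma C_op_adj_eq_cond_exp: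
  assumes H: "H \<in> L2 M"
  shows "AE \<omega> in M. C_op X (adj H) \<omega> = vec_cond_exp M (sigma_gen M X) H \<omega>"
proof -
  obtain \<zeta> where \<zeta>: "\<zeta> \<in> L2 law"
    and E_eq: "\<And>\<omega>. \<omega> \<in> space M \<Longrightarrow> vec_cond_exp M (sigma_gen M X) H \<omega> = C_op X \<zeta> \<omega>"
    and inner: "\<And>\<xi>. \<xi> \<in> L2 law \<Longrightarrow> L2_inner law \<zeta> \<xi> = L2_inner M H (C_op X \<xi>)"
    by (rule vec_cond_exp_factor[OF H]) (rule that)
  have "AE x in law. \<zeta> x = adj H x" by (rule adj_unique[OF H \<zeta> inner])
  from C_op_cong_AE[OF this] AE_space show ?thesis
    by eventually_elim (simp add: E_eq)
qed

text \<open>By the defining equation of the adjoint and the isometry, \<open>H - C C\<^sup>* H\<close> is orthogonal to the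
  range of \<open>C\<close>, which is the whole subspace up to null sets.\<close>

lemma C_op_adj_orthogonal_projection:
  "L2_orthogonal_projection M (L2_sigma M X) (\<lambda>H. C_op X (adj H))"
  unfolding L2_orthogonal_projection_def
proof (intro ballI conjI)
  fix H :: "'w \<Rightarrow> real ^ 'd" assume H: "H \<in> L2 M"
  note a = adj_in_L2[OF H]
  show "C_op X (adj H) \<in> L2_sigma M X" by (rule C_op_in_L2_sigma[OF a])
  fix G assume G: "G \<in> L2_sigma M X"
  obtain \<xi> where \<xi>: "\<xi> \<in> L2 law" and G_eq: "AE \<omega> in M. G \<omega> = C_op X \<xi> \<omega>"
    using L2_sigma_obtain_C_op[OF G] by blast
  have G_L2: "G \<in> L2 M" using G by (simp add: L2_sigma_def)
  note D = L2_diff[OF H C_op_L2[OF a]]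
  have "L2_inner M (\<lambda>\<omega>. H \<omega> - C_op X (adj H) \<omega>) G
      = L2_inner M (\<lambda>\<omega>. H \<omega> - C_op X (adj H) \<omega>) (C_op X \<xi>)"
    by (rule L2_inner_cong_AE[OF D D G_L2 C_op_L2[OF \<xi>] _ G_eq]) simp
  also have "\<dots> = L2_inner M H (C_op X \<xi>) - L2_inner M (C_op X (adj H)) (C_op X \<xi>)"
    by (rule L2_inner_diff_left[OF H C_op_L2[OF a] C_op_L2[OF \<xi>]])
  also have "\<dots> = 0" by (simp add: C_op_inner a \<xi> adj_inner H)
  finally show "L2_inner M (\<lambda>\<omega>. H \<omega> - C_op X (adj H) \<omega>) G = 0" .
qed

text \<open>
  Uniqueness of the adjoint gives linearity almost everywhere. For the bound, take the adjoint
  equation at \<open>\<xi> = adj f\<close> and apply Cauchy--Schwarz.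
\<close>

lemma adj_bounded: "L2_bounded_operator M law adj"
proof (rule L2_bounded_operatorI[where c = 1])
  fix f g :: "'w \<Rightarrow> real ^ 'd" and a b :: real assume f: "f \<in> L2 M" and g: "g \<in> L2 M"
  have "AE x in law. a *\<^sub>R adj f x + b *\<^sub>R adj g x = adj (\<lambda>x. a *\<^sub>R f x + b *\<^sub>R g x) x"
    by (rule adj_unique)
       (simp_all add: f g L2_lincomb adj_in_L2 L2_inner_lincomb_left adj_inner C_op_L2)
  then show "AE x in law. adj (\<lambda>x. a *\<^sub>R f x + b *\<^sub>R g x) x = a *\<^sub>R adj f x + b *\<^sub>R adj g x"
    by eventually_elim simp
next
  fix f :: "'w \<Rightarrow> real ^ 'd" assume f: "f \<in> L2 M"
  note a = adj_in_L2[OF f]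
  show "adj f \<in> L2 law" by (fact a)
  have "(L2_norm law (adj f))\<^sup>2 = L2_inner M f (C_op X (adj f))"
    by (simp add: L2_norm_sq adj_inner[OF f a])
  also have "\<dots> \<le> L2_norm M f * L2_norm law (adj f)"
    using L2_Cauchy_Schwarz[OF f C_op_L2[OF a]] by (simp add: C_op_norm[OF a])
  finally have "L2_norm law (adj f) * L2_norm law (adj f) \<le> L2_norm M f * L2_norm law (adj f)"
    by (simp add: power2_eq_square)
  then show "L2_norm law (adj f) \<le> 1 * L2_norm M f"
    using L2_norm_nonneg[of law "adj f"] L2_norm_nonneg[of M f]
    by (cases "L2_norm law (adj f) = 0") (simp_all add: mult_le_cancel_right)
qed

lemma L2_sigma_if_projection_fixed:
  assumes f: "f \<in> L2 M" and eq: "AE \<omega> in M. C_op X (adj f) \<omega> = f \<omega>"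
  shows "f \<in> L2_sigma M X"
  by (rule L2_sigma_cong_AE[OF C_op_in_L2_sigma[OF adj_in_L2[OF f]] f eq])

lemma C_op_adj_fixes_L2_sigma:
  assumes G: "G \<in> L2_sigma M X"
  shows "AE \<omega> in M. C_op X (adj G) \<omega> = G \<omega>"
proof -
  obtain \<xi> where \<xi>: "\<xi> \<in> L2 law" and G_eq: "AE \<omega> in M. G \<omega> = C_op X \<xi> \<omega>"
    using L2_sigma_obtain_C_op[OF G] by blast
  have G_L2: "G \<in> L2 M" using G by (simp add: L2_sigma_def)
  have "AE x in law. \<xi> x = adj G x"
  proof (rule adj_unique[OF G_L2 \<xi>])
    fix \<eta> :: "real ^ 'd \<Rightarrow> real ^ 'd" assume \<eta>: "\<eta> \<in> L2 law"
    have "L2_inner M G (C_op X \<eta>) = L2_inner M (C_op X \<xi>) (C_op X \<eta>)"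
      by (rule L2_inner_cong_AE[OF G_L2 C_op_L2[OF \<xi>] C_op_L2[OF \<eta>] C_op_L2[OF \<eta>] G_eq]) simp
    then show "L2_inner law \<xi> \<eta> = L2_inner M G (C_op X \<eta>)" by (simp add: C_op_inner \<xi> \<eta>)
  qed
  from C_op_cong_AE[OF this] G_eq show ?thesis by eventually_elim simp
qed

text \<open>
  Let \<open>u n\<close> tend to \<open>f\<close> and let \<open>P = C C\<^sup>*\<close>. Since \<open>f - P f\<close> is orthogonal to \<open>u n - P f\<close>, its squared
  norm is its inner product with \<open>f - u n\<close>, which tends to zero. Hence \<open>f = P f\<close> almost
  everywhere, and the subspace contains every field that agrees with a member almost everywhere.
\<close>

lemma L2_sigma_closed_subspace: "L2_closed_subspace M (L2_sigma M X)"
  unfolding L2_closed_subspace_def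
proof (intro conjI ballI allI impI)
  show "L2_sigma M X \<subseteq> L2 M" by (auto simp: L2_sigma_def)
  show "(\<lambda>\<omega>. 0) \<in> L2_sigma M X" by (auto simp: L2_sigma_def L2_zero)
next
  fix f g a b assume "f \<in> L2_sigma M X" "g \<in> L2_sigma M X"
  then show "(\<lambda>\<omega>. a *\<^sub>R f \<omega> + b *\<^sub>R g \<omega>) \<in> L2_sigma M X" by (rule L2_sigma_lincomb)
next
  fix u :: "nat \<Rightarrow> 'w \<Rightarrow> real ^ 'd" and f
  assume f: "f \<in> L2 M"
    and "(\<forall>n. u n \<in> L2_sigma M X) \<and> (\<lambda>n. L2_norm M (\<lambda>\<omega>. u n \<omega> - f \<omega>)) \<longlonglongrightarrow> 0"
  then have u: "u n \<in> L2_sigma M X" and lim: "(\<lambda>n. L2_norm M (\<lambda>\<omega>. u n \<omega> - f \<omega>)) \<longlonglongrightarrow> 0" for n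
    by auto
  define P where "P = C_op X (adj f)"
  define r where "r = (\<lambda>\<omega>. f \<omega> - P \<omega>)"
  have P_sigma: "P \<in> L2_sigma M X" and orth: "\<And>g. g \<in> L2_sigma M X \<Longrightarrow> L2_inner M r g = 0"
    using C_op_adj_orthogonal_projection f
    by (auto simp: L2_orthogonal_projection_def P_def r_def)
  have P: "P \<in> L2 M" and u_L2: "u n \<in> L2 M" for n using P_sigma u by (auto simp: L2_sigma_def)
  have r: "r \<in> L2 M" unfolding r_def by (rule L2_diff[OF f P])
  have "(L2_norm M r)\<^sup>2 \<le> L2_norm M r * L2_norm M (\<lambda>\<omega>. u n \<omega> - f \<omega>)" for n
  proof -
    have "L2_inner M (\<lambda>\<omega>. u n \<omega> - f \<omega>) r = L2_inner M r (u n) - L2_inner M r f"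
      using L2_inner_diff_left[OF u_L2[of n] f r]
        L2_inner_commute[of M "u n" r] L2_inner_commute[of M f r] by simp
    moreover have "L2_inner M r r = L2_inner M f r - L2_inner M P r"
      using L2_inner_diff_left[OF f P r] by (simp add: r_def)
    ultimately have "L2_inner M r r = - L2_inner M (\<lambda>\<omega>. u n \<omega> - f \<omega>) r"
      using orth[OF u[of n]] orth[OF P_sigma] L2_inner_commute[of M f r] L2_inner_commute[of M P r]
      by simp
    then show ?thesis
      using L2_Cauchy_Schwarz[OF L2_diff[OF u_L2[of n] f] r]
      unfolding L2_norm_sq by (simp add: mult.commute)
  qed
  moreover have "(\<lambda>n. L2_norm M r * L2_norm M (\<lambda>\<omega>. u n \<omega> - f \<omega>)) \<longlonglongrightarrow> 0"
    using tendsto_mult_left[OF lim, of "L2_norm M r"] by simp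
  ultimately have "(L2_norm M r)\<^sup>2 \<le> 0" by (intro LIMSEQ_le_const) auto
  then have "L2_norm M r = 0" by simp
  then have "AE \<omega> in M. f \<omega> = P \<omega>" unfolding r_def by (rule L2_eq_AE_if_norm_diff_zero[OF f P])
  then show "f \<in> L2_sigma M X"
    by (intro L2_sigma_if_projection_fixed[OF f]) (auto simp: P_def)
qed

end

section \<open>Regularity of the Wasserstein derivatives at a fixed measure\<close>

text \<open>The plan concentrated on the diagonal has zero cost.\<close>

lemma W2_self_le_0:
  assumes "\<mu> \<in> P2"
  shows "W2 \<mu> \<mu> \<le> 0"
proof -
  have prob: "prob_space \<mu>" and sets: "sets \<mu> = sets borel" using assms by (auto simp: P2_def)
  define \<gamma> where "\<gamma> = distr \<mu> (borel \<Otimes>\<^sub>M borel) (\<lambda>x. (x, x))"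
  have diag[measurable]: "(\<lambda>x. (x, x)) \<in> measurable \<mu> (borel \<Otimes>\<^sub>M borel)"
    unfolding measurable_cong_sets[OF sets refl] by measurable
  have "distr \<mu> borel (\<lambda>x. x) = \<mu>" by (rule distr_id2) (rule sets[symmetric])
  then have "\<gamma> \<in> transport_plans \<mu> \<mu>"
    unfolding transport_plans_def \<gamma>_def
    by (simp add: prob_space.prob_space_distr[OF prob diag] distr_distr comp_def)
  moreover have "W2_plan \<gamma> = 0"
    unfolding W2_plan_def \<gamma>_def by (subst integral_distr[OF diag]) simp_all
  moreover have "bdd_below (W2_plan ` transport_plans \<mu> \<mu>)"
    by (rule bdd_belowI2[where m = 0]) (simp add: W2_plan_def)
  ultimately show ?thesis unfolding W2_def by (metis cINF_lower)
qed

text \<open>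
  Joint continuity at \<open>(\<mu>, x)\<close> may be tested at the points \<open>(\<mu>, y)\<close>, because \<open>\<mu>\<close> is at distance
  zero from itself.
\<close>

lemma P2_continuous_fixed_measure:
  assumes F: "P2_continuous F" and \<mu>: "\<mu> \<in> P2"
  shows "continuous_on UNIV (F \<mu>)"
  unfolding continuous_on_iff
proof (intro ballI allI impI)
  fix x and e :: real assume "0 < e"
  then obtain r where "0 < r"
    and r: "\<And>y. W2 \<mu> \<mu> < r \<and> dist x y < r \<Longrightarrow> dist (F \<mu> x) (F \<mu> y) < e"
    using F \<mu> unfolding P2_continuous_def by meson
  then show "\<exists>d>0. \<forall>y\<in>UNIV. dist y x < d \<longrightarrow> dist (F \<mu> y) (F \<mu> x) < e"
    using W2_self_le_0[OF \<mu>] by (intro exI[of _ r]) (auto simp: dist_commute)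
qed

lemma W_grad_x_measurable:
  assumes "C2b \<Phi>" "\<mu> \<in> P2"
  shows "W_grad_x \<Phi> \<mu> \<in> borel_measurable borel"
proof -
  have "P2_continuous (\<lambda>\<mu> x. W_grad_x \<Phi> \<mu> x)"
    using C2b_with_W_grad[OF assms(1)] by (simp add: C2b_with_def W_grad_x_def)
  from P2_continuous_fixed_measure[OF this assms(2)] show ?thesis
    by (rule borel_measurable_continuous_onI)
qed

lemma W_grad_x_bounded:
  assumes "C2b \<Phi>" "\<mu> \<in> P2"
  obtains c where "\<And>x. norm (W_grad_x \<Phi> \<mu> x) \<le> c"
proof -
  have "P2_bounded (\<lambda>\<mu> x. W_grad_x \<Phi> \<mu> x)"
    using C2b_with_W_grad[OF assms(1)] by (simp add: C2b_with_def W_grad_x_def)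
  with assms(2) that show thesis unfolding P2_bounded_def by blast
qed

lemma W_grad2_measurable:
  assumes "C2b \<Phi>" "\<mu> \<in> P2"
  shows "(\<lambda>(x, y). W_grad2 \<Phi> \<mu> x y) \<in> borel_measurable (borel \<Otimes>\<^sub>M borel)"
proof -
  have "P2_continuous (\<lambda>\<mu> (x, y). W_grad2 \<Phi> \<mu> x y)"
    using C2b_with_W_grad[OF assms(1)] by (simp add: C2b_with_def)
  from P2_continuous_fixed_measure[OF this assms(2)] show ?thesis
    unfolding borel_prod by (rule borel_measurable_continuous_onI)
qed

lemma W_grad2_bounded:
  assumes "C2b \<Phi>" "\<mu> \<in> P2"
  obtains c where "\<And>x y. norm (W_grad2 \<Phi> \<mu> x y) \<le> c"
proof -
  have "P2_bounded (\<lambda>\<mu> (x, y). W_grad2 \<Phi> \<mu> x y)"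
    using C2b_with_W_grad[OF assms(1)] by (simp add: C2b_with_def)
  then obtain c where "\<forall>\<mu>\<in>P2. \<forall>p. norm (case p of (x, y) \<Rightarrow> W_grad2 \<Phi> \<mu> x y) \<le> c"
    unfolding P2_bounded_def by blast
  then have "norm (W_grad2 \<Phi> \<mu> x y) \<le> c" for x y
    using assms(2) by (metis case_prod_conv)
  from that[OF this] show thesis .
qed

lemma M_op_bounded:
  assumes "C2b \<Phi>" "\<mu> \<in> P2" and X: "X \<in> borel_measurable M"
  shows "L2_bounded_operator M M (M_op \<Phi> \<mu> X)"
proof -
  obtain c where "\<And>x. norm (W_grad_x \<Phi> \<mu> x) \<le> c" using W_grad_x_bounded[OF assms(1,2)] by blast
  from L2_bounded_operator_multiplication[OF measurable_compose[OF X W_grad_x_measurable] this]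
    assms(1,2)
  have "L2_bounded_operator M M (\<lambda>f \<omega>. W_grad_x \<Phi> \<mu> (X \<omega>) *v f \<omega>)" by blast
  then show ?thesis unfolding M_op_def[abs_def] .
qed

lemma K_op_bounded:
  assumes "C2b \<Phi>" and \<mu>: "\<mu> \<in> P2"
  shows "L2_bounded_operator \<mu> \<mu> (K_op \<Phi> \<mu>)"
proof -
  have prob: "prob_space \<mu>" and sets: "sets \<mu> = sets borel" using \<mu> by (auto simp: P2_def)
  obtain c where c: "\<And>x y. norm (W_grad2 \<Phi> \<mu> x y) \<le> c" using W_grad2_bounded[OF assms] by blast
  have "(\<lambda>(x, y). W_grad2 \<Phi> \<mu> x y) \<in> borel_measurable (\<mu> \<Otimes>\<^sub>M \<mu>)"
    using W_grad2_measurable[OF assms]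
      measurable_cong_sets[OF sets_pair_measure_cong[OF sets sets] refl] by blast
  from L2_bounded_operator_kernel[OF prob this c] show ?thesis unfolding K_op_def[abs_def] .
qed

text \<open>On \<open>L\<^sup>2(\<mu>)\<close> the multiplication part of the Wasserstein Hessian is \<open>M_op\<close> for the identity
  field.\<close>

lemma W_hess_bounded:
  assumes "C2b \<Phi>" and \<mu>: "\<mu> \<in> P2"
  shows "L2_bounded_operator \<mu> \<mu> (W_hess \<Phi> \<mu>)"
proof -
  have "sets \<mu> = sets borel" using \<mu> by (simp add: P2_def)
  then have "(\<lambda>x. x) \<in> borel_measurable \<mu>" by (rule measurable_ident_sets)
  from L2_bounded_operator_add[OF M_op_bounded[OF assms this] K_op_bounded[OF assms]]
  show ?thesis by (simp add: W_hess_def[abs_def] M_op_def[abs_def] K_op_def[abs_def])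
qed

section \<open>The Hessian of the lift\<close>

lemma L2_represents_unique:
  assumes A: "L2_represents M A b" and A': "L2_represents M A' b" and H: "H \<in> L2 M"
  shows "AE \<omega> in M. A H \<omega> = A' H \<omega>"
proof (rule L2_eq_AE_if_same_inner)
  show "A H \<in> L2 M" "A' H \<in> L2 M"
    using A A' H by (auto simp: L2_represents_def intro: L2_bounded_operatorD(1))
  show "L2_inner M (A H) h = L2_inner M (A' H) h" if "h \<in> L2 M" for h
    using A A' H that by (simp add: L2_represents_def)
qed

context random_vector
begin

lemma law_in_P2:
  assumes "X \<in> L2 M"
  shows "law \<in> P2"
proof -
  have "integrable law (\<lambda>x. (norm x)\<^sup>2) \<longleftrightarrow> integrable M (\<lambda>\<omega>. (norm (X \<omega>))\<^sup>2)"
    by (rule integrable_distr_eq) measurable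
  with L2_integrable_sq[OF assms] prob_space_law show ?thesis by (simp add: P2_def)
qed

text \<open>
  Each row of the bounded matrix field \<open>k\<close> is a test field in \<open>L\<^sup>2(law)\<close>, so the adjoint may be
  traded for the field itself row by row.
\<close>

lemma integral_matrix_adj:
  fixes k :: "real ^ 'd \<Rightarrow> real ^ 'd ^ 'd"
  assumes k[measurable]: "k \<in> borel_measurable borel" and c: "\<And>y. norm (k y) \<le> c"
    and G: "G \<in> L2 M"
  shows "integrable M (\<lambda>\<theta>. k (X \<theta>) *v G \<theta>)"
    and "(\<integral>y. k y *v adj G y \<partial>law) = (\<integral>\<theta>. k (X \<theta>) *v G \<theta> \<partial>M)"
proof -
  interpret law: prob_space law by (rule prob_space_law)
  have "(\<lambda>\<theta>. k (X \<theta>) *v G \<theta>) \<in> L2 M"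
    by (rule L2_bounded_operatorD(1)[OF L2_bounded_operator_multiplication _ ])
       (use c G in measurable)
  then show int_M: "integrable M (\<lambda>\<theta>. k (X \<theta>) *v G \<theta>)" by (rule L2_integrable)
  have k_law: "k \<in> borel_measurable law" by simp
  have int_law: "integrable law (\<lambda>y. k y *v adj G y)"
    by (rule law.L2_integrable[OF L2_bounded_operatorD(1)[OF
          L2_bounded_operator_multiplication[OF k_law c] adj_in_L2[OF G]]])
  show "(\<integral>y. k y *v adj G y \<partial>law) = (\<integral>\<theta>. k (X \<theta>) *v G \<theta> \<partial>M)"
  proof (rule vec_eq_iff[THEN iffD2], rule allI)
    fix i
    have row: "(\<lambda>y. k y $ i) \<in> L2 law"
    proof (rule law.bounded_in_L2(1))
      show "(\<lambda>y. k y $ i) \<in> borel_measurable law" by (rule borel_measurable_vec_nth[OF k_law])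
      show "norm (k y $ i) \<le> c" for y
        using Finite_Cartesian_Product.norm_nth_le[of "k y" i] c[of y] by simp
    qed
    have "(\<integral>y. k y *v adj G y \<partial>law) $ i = (\<integral>y. (k y *v adj G y) $ i \<partial>law)"
      by (rule integral_bounded_linear[OF bounded_linear_vec_nth int_law, symmetric])
    also have "\<dots> = L2_inner law (adj G) (\<lambda>y. k y $ i)"
      by (simp add: L2_inner_def matrix_vector_mul_component inner_commute)
    also have "\<dots> = L2_inner M G (C_op X (\<lambda>y. k y $ i))" by (rule adj_inner[OF G row])
    also have "\<dots> = (\<integral>\<theta>. (k (X \<theta>) *v G \<theta>) $ i \<partial>M)"
      by (simp add: L2_inner_def C_op_def matrix_vector_mul_component inner_commute)
    also have "\<dots> = (\<integral>\<theta>. k (X \<theta>) *v G \<theta> \<partial>M) $ i"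
      by (rule integral_bounded_linear[OF bounded_linear_vec_nth int_M])
    finally show "(\<integral>y. k y *v adj G y \<partial>law) $ i = (\<integral>\<theta>. k (X \<theta>) *v G \<theta> \<partial>M) $ i" .
  qed
qed

definition lift_hess_op ::
    "((real ^ 'd) measure \<Rightarrow> real) \<Rightarrow> ('w \<Rightarrow> real ^ 'd) \<Rightarrow> ('w \<Rightarrow> real ^ 'd)" where
  "lift_hess_op \<Phi> H \<omega> = M_op \<Phi> law X H \<omega> + C_op X (K_op \<Phi> law (adj H)) \<omega>"

text \<open>
  The inner integral of the second term of the form is, for fixed \<open>\<omega>\<close>, the inner product of \<open>H \<omega>\<close>
  with \<open>\<integral>\<theta>. W_grad2 \<Phi> law (X \<omega>) (X \<theta>) *v G \<theta> \<partial>M\<close>, which is the value of \<open>C K C\<^sup>* G\<close> at \<open>\<omega>\<close> by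
  the previous lemma.
\<close>

lemma lift_hess_op_represents:
  assumes X: "X \<in> L2 M" and \<Phi>: "C2b \<Phi>"
  shows "L2_represents M (lift_hess_op \<Phi>) (lift_hess M \<Phi> X)"
proof -
  note law = law_in_P2[OF X]
  note M_bdd = M_op_bounded[OF \<Phi> law X_measurable]
  have C_bdd: "L2_bounded_operator law M (C_op X)"
    using C_op_isometry by (simp add: L2_isometry_def)
  note CKC_bdd = L2_bounded_operator_compose[OF
      L2_bounded_operator_compose[OF adj_bounded K_op_bounded[OF \<Phi> law]] C_bdd]
  show ?thesis
    unfolding L2_represents_def
  proof (intro conjI ballI)
    show "L2_bounded_operator M M (lift_hess_op \<Phi>)"
      using L2_bounded_operator_add[OF M_bdd CKC_bdd] unfolding lift_hess_op_def[abs_def] .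
    fix G H :: "'w \<Rightarrow> real ^ 'd" assume G: "G \<in> L2 M" and H: "H \<in> L2 M"
    obtain c where c: "\<And>x y. norm (W_grad2 \<Phi> law x y) \<le> c"
      using W_grad2_bounded[OF \<Phi> law] by blast
    have k_meas: "W_grad2 \<Phi> law x \<in> borel_measurable borel" for x
      using measurable_Pair2[OF W_grad2_measurable[OF \<Phi> law], of x] by simp
    have K: "C_op X (K_op \<Phi> law (adj G)) \<omega> \<bullet> H \<omega>
      = (\<integral>\<theta>. (W_grad2 \<Phi> law (X \<omega>) (X \<theta>) *v G \<theta>) \<bullet> H \<omega> \<partial>M)" for \<omega>
      using integral_matrix_adj[OF k_meas c G, of "X \<omega>"]
      by (simp add: C_op_def K_op_def)
    have "L2_inner M (lift_hess_op \<Phi> G) H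
      = L2_inner M (M_op \<Phi> law X G) H + L2_inner M (C_op X (K_op \<Phi> law (adj G))) H"
      unfolding lift_hess_op_def[abs_def]
      by (rule L2_inner_add_left[OF L2_bounded_operatorD(1)[OF M_bdd G]
            L2_bounded_operatorD(1)[OF CKC_bdd G] H])
    then show "L2_inner M (lift_hess_op \<Phi> G) H = lift_hess M \<Phi> X G H"
      by (simp add: lift_hess_def L2_inner_def M_op_def K)
  qed
qed

text \<open>On the subspace, \<open>H = (adj H) \<circ> X\<close> almost everywhere, so the multiplication part becomes a function of
  \<open>X\<close> as well.\<close>

lemma lift_hess_op_on_L2_sigma:
  assumes H: "H \<in> L2_sigma M X"
  shows "AE \<omega> in M. lift_hess_op \<Phi> H \<omega> = C_op X (W_hess \<Phi> law (adj H)) \<omega>"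
  using C_op_adj_fixes_L2_sigma[OF H]
  by eventually_elim (simp add: lift_hess_op_def M_op_def K_op_def C_op_def W_hess_def)

end

section \<open>Pullback by a random vector and the Hessian of the lift\<close>

theorem lemma2p6:
  fixes M :: "'w measure"
    and X :: "'w \<Rightarrow> real ^ 'd"
    and \<mu> :: "(real ^ 'd) measure"
    and \<Phi> :: "(real ^ 'd) measure \<Rightarrow> real"
  assumes "standard_prob_space M" and "atomless M"
    and "X \<in> L2 M"
    and "\<mu> = distr M borel X"
  shows "\<mu> \<in> P2
    \<and> L2_isometry \<mu> M (C_op X)
    \<and> L2_closed_subspace M (L2_sigma M X)
    \<and> (\<forall>\<xi> \<in> L2 \<mu>. C_op X \<xi> \<in> L2_sigma M X)
    \<and> (\<forall>G \<in> L2_sigma M X. \<exists>\<xi> \<in> L2 \<mu>. AE \<omega> in M. G \<omega> = C_op X \<xi> \<omega>)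
    \<and> L2_bounded_operator M \<mu> (L2_adjoint \<mu> M (C_op X))
    \<and> (\<forall>H \<in> L2 M. \<forall>\<xi> \<in> L2 \<mu>.
         (\<integral>x. L2_adjoint \<mu> M (C_op X) H x \<bullet> \<xi> x \<partial>\<mu>) = (\<integral>\<omega>. H \<omega> \<bullet> (\<xi> \<circ> X) \<omega> \<partial>M))
    \<and> (\<forall>H \<in> L2 M. \<forall>\<eta> \<in> L2 \<mu>.
         (\<forall>\<xi> \<in> L2 \<mu>. (\<integral>x. \<eta> x \<bullet> \<xi> x \<partial>\<mu>) = (\<integral>\<omega>. H \<omega> \<bullet> (\<xi> \<circ> X) \<omega> \<partial>M)) \<longrightarrow>
         (AE x in \<mu>. \<eta> x = L2_adjoint \<mu> M (C_op X) H x))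
    \<and> L2_orthogonal_projection M (L2_sigma M X) (\<lambda>H. C_op X (L2_adjoint \<mu> M (C_op X) H))
    \<and> (\<forall>H \<in> L2 M. AE \<omega> in M.
         C_op X (L2_adjoint \<mu> M (C_op X) H) \<omega> = vec_cond_exp M (sigma_gen M X) H \<omega>)
    \<and> (C2b \<Phi> \<longrightarrow>
         L2_bounded_operator M M (M_op \<Phi> \<mu> X)
       \<and> L2_bounded_operator \<mu> \<mu> (K_op \<Phi> \<mu>)
       \<and> L2_bounded_operator \<mu> \<mu> (W_hess \<Phi> \<mu>)
       \<and> (\<exists>A. L2_represents M A (lift_hess M \<Phi> X))
       \<and> (\<forall>A. L2_represents M A (lift_hess M \<Phi> X) \<longrightarrow>
            (\<forall>H \<in> L2 M. AE \<omega> in M.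
               A H \<omega> = M_op \<Phi> \<mu> X H \<omega> + C_op X (K_op \<Phi> \<mu> (L2_adjoint \<mu> M (C_op X) H)) \<omega>)
          \<and> (\<forall>H \<in> L2_sigma M X. A H \<in> L2_sigma M X)
          \<and> (\<forall>H \<in> L2_sigma M X. AE \<omega> in M.
               A H \<omega> = C_op X (W_hess \<Phi> \<mu> (L2_adjoint \<mu> M (C_op X) H)) \<omega>)))"
proof -
  interpret prob_space M using assms(1) by (simp add: standard_prob_space_def)
  interpret random_vector M X by unfold_locales (rule L2_measurable[OF assms(3)])
  have \<mu>: "law \<in> P2" by (rule law_in_P2[OF assms(3)])
  have inner: "(\<integral>x. adj H x \<bullet> \<xi> x \<partial>law) = (\<integral>\<omega>. H \<omega> \<bullet> (\<xi> \<circ> X) \<omega> \<partial>M)"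
    if "H \<in> L2 M" "\<xi> \<in> L2 law" for H \<xi>
    using adj_inner[OF that] by (simp add: L2_inner_def C_op_def)
  have unique: "(\<forall>\<xi> \<in> L2 law. (\<integral>x. \<eta> x \<bullet> \<xi> x \<partial>law) = (\<integral>\<omega>. H \<omega> \<bullet> (\<xi> \<circ> X) \<omega> \<partial>M)) \<longrightarrow>
      (AE x in law. \<eta> x = adj H x)"
    if "H \<in> L2 M" "\<eta> \<in> L2 law" for H \<eta>
    using adj_unique[OF that] by (simp add: L2_inner_def C_op_def)
  have range: "\<exists>\<xi> \<in> L2 law. AE \<omega> in M. G \<omega> = C_op X \<xi> \<omega>" if "G \<in> L2_sigma M X" for G
    using L2_sigma_obtain_C_op[OF that] by blast
  have hess: "C2b \<Phi> \<longrightarrow> L2_bounded_operator M M (M_op \<Phi> law X)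
       \<and> L2_bounded_operator law law (K_op \<Phi> law)
       \<and> L2_bounded_operator law law (W_hess \<Phi> law)
       \<and> (\<exists>A. L2_represents M A (lift_hess M \<Phi> X))
       \<and> (\<forall>A. L2_represents M A (lift_hess M \<Phi> X) \<longrightarrow>
            (\<forall>H \<in> L2 M. AE \<omega> in M.
               A H \<omega> = M_op \<Phi> law X H \<omega> + C_op X (K_op \<Phi> law (adj H)) \<omega>)
          \<and> (\<forall>H \<in> L2_sigma M X. A H \<in> L2_sigma M X)
          \<and> (\<forall>H \<in> L2_sigma M X. AE \<omega> in M. A H \<omega> = C_op X (W_hess \<Phi> law (adj H)) \<omega>))"
  proof (rule impI, intro conjI allI impI ballI)
    assume \<Phi>: "C2b \<Phi>"
    show "L2_bounded_operator M M (M_op \<Phi> law X)" by (rule M_op_bounded[OF \<Phi> \<mu> X_measurable])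
    show "L2_bounded_operator law law (K_op \<Phi> law)" by (rule K_op_bounded[OF \<Phi> \<mu>])
    show W: "L2_bounded_operator law law (W_hess \<Phi> law)" by (rule W_hess_bounded[OF \<Phi> \<mu>])
    note rep = lift_hess_op_represents[OF assms(3) \<Phi>]
    then show "\<exists>A. L2_represents M A (lift_hess M \<Phi> X)" by blast
    fix A assume A: "L2_represents M A (lift_hess M \<Phi> X)"
    show "AE \<omega> in M. A H \<omega> = M_op \<Phi> law X H \<omega> + C_op X (K_op \<Phi> law (adj H)) \<omega>"
      if "H \<in> L2 M" for H
      using L2_represents_unique[OF A rep that] by (simp add: lift_hess_op_def)
    show sub: "AE \<omega> in M. A H \<omega> = C_op X (W_hess \<Phi> law (adj H)) \<omega>"
      if "H \<in> L2_sigma M X" for H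
    proof -
      have "H \<in> L2 M" using that by (simp add: L2_sigma_def)
      from L2_represents_unique[OF A rep this] lift_hess_op_on_L2_sigma[OF that]
      show ?thesis by eventually_elim simp
    qed
    show "A H \<in> L2_sigma M X" if H: "H \<in> L2_sigma M X" for H
    proof (rule L2_sigma_cong_AE)
      have H_L2: "H \<in> L2 M" using H by (simp add: L2_sigma_def)
      show "C_op X (W_hess \<Phi> law (adj H)) \<in> L2_sigma M X"
        by (rule C_op_in_L2_sigma[OF L2_bounded_operatorD(1)[OF W adj_in_L2[OF H_L2]]])
      show "A H \<in> L2 M"
        using A H_L2 by (auto simp: L2_represents_def intro: L2_bounded_operatorD(1))
      show "AE \<omega> in M. C_op X (W_hess \<Phi> law (adj H)) \<omega> = A H \<omega>"
        using sub[OF H] by eventually_elim simp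
    qed
  qed
  show ?thesis
    unfolding assms(4)
    by (intro conjI ballI \<mu> C_op_isometry L2_sigma_closed_subspace C_op_in_L2_sigma range
        adj_bounded inner unique C_op_adj_orthogonal_projection C_op_adj_eq_cond_exp hess)
qed

end
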